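(* Let $H$ be a cosemisimple Hopf algebra over a field $k$ with antipode $S$. Then there exists an invertible element $u$ of the algebra $H^*$ such that $S^2(h)=u^{-1}\cdot h\cdot u$ for all $h\in H$.
   Context: $H^*=\mathrm{Hom}_k(H,k)$ is an algebra with the convolution product $(c^*d^* )(x)=\sum c^*(x_1)d^*(x_2)$, where $\Delta(x)=\sum x_1\otimes x_2$. $H$ is an $(H^*,H^* )$-bimodule with $c^*\cdot x=\sum c^*(x_2)x_1$ and $x\cdot c^*=\sum c^*(x_1)x_2$. $H$ is cosemisimple if its underlying coalgebra is a direct sum of simple subcoalgebras. $H$ is not assumed finite dimensional. *)

theory Defs
  imports Complex_Main "HOL-Library.Poly_Mapping" "HOL-Algebra.Ring"
begin

section \<open>Tensor products over a field\<close>

text \<open>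
  The tensor products \<open>V \<otimes> V\<close> and \<open>V \<otimes> V \<otimes> V\<close> are the quotients of the free vector spaces on
  \<open>V \<times> V\<close> and \<open>V \<times> V \<times> V\<close> by the subspaces spanned by the multilinearity relations. Every tensor is
  a finite sum of pure tensors, so tensors are written as finite lists: the list
  \<open>[(a\<^sub>1, b\<^sub>1), \<dots>, (a\<^sub>n, b\<^sub>n)]\<close> stands for \<open>a\<^sub>1 \<otimes> b\<^sub>1 + \<dots> + a\<^sub>n \<otimes> b\<^sub>n\<close>. Distinct lists may
  represent the same tensor; equality in the quotient is \<open>tensor_eq2\<close> resp. \<open>tensor_eq3\<close>.
\<close>

definition free_scale :: "'k::field \<Rightarrow> ('x \<Rightarrow>\<^sub>0 'k) \<Rightarrow> ('x \<Rightarrow>\<^sub>0 'k)" where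
  "free_scale c p = Poly_Mapping.map (\<lambda>a. c * a) p"

lemma lookup_free_scale [simp]:
  "Poly_Mapping.lookup (free_scale c p) x = c * Poly_Mapping.lookup p x"
  by (simp add: free_scale_def Poly_Mapping.map.rep_eq when_def)

global_interpretation free: vector_space "free_scale :: 'k::field \<Rightarrow> ('x \<Rightarrow>\<^sub>0 'k) \<Rightarrow> ('x \<Rightarrow>\<^sub>0 'k)"
  by unfold_locales
    (auto intro!: poly_mapping_eqI simp: Poly_Mapping.lookup_add algebra_simps)

definition formal_sum :: "'x list \<Rightarrow> ('x \<Rightarrow>\<^sub>0 'k::field)" where
  "formal_sum ts = (\<Sum>t\<leftarrow>ts. Poly_Mapping.single t 1)"

locale tensor_space = vector_space scale
  for scale :: "'k::field \<Rightarrow> 'v::ab_group_add \<Rightarrow> 'v"  (infixr \<open>*s\<close> 75)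
begin

definition bilinear_relations :: "(('v \<times> 'v) \<Rightarrow>\<^sub>0 'k) set" where
  "bilinear_relations =
     {formal_sum [(x + x', y)] - formal_sum [(x, y), (x', y)] | x x' y. True} \<union>
     {formal_sum [(x, y + y')] - formal_sum [(x, y), (x, y')] | x y y'. True} \<union>
     {formal_sum [(c *s x, y)] - free_scale c (formal_sum [(x, y)]) | c x y. True} \<union>
     {formal_sum [(x, c *s y)] - free_scale c (formal_sum [(x, y)]) | c x y. True}"

definition trilinear_relations :: "(('v \<times> 'v \<times> 'v) \<Rightarrow>\<^sub>0 'k) set" where
  "trilinear_relations =
     {formal_sum [(x + x', y, z)] - formal_sum [(x, y, z), (x', y, z)] | x x' y z. True} \<union>
     {formal_sum [(x, y + y', z)] - formal_sum [(x, y, z), (x, y', z)] | x y y' z. True} \<union>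
     {formal_sum [(x, y, z + z')] - formal_sum [(x, y, z), (x, y, z')] | x y z z'. True} \<union>
     {formal_sum [(c *s x, y, z)] - free_scale c (formal_sum [(x, y, z)]) | c x y z. True} \<union>
     {formal_sum [(x, c *s y, z)] - free_scale c (formal_sum [(x, y, z)]) | c x y z. True} \<union>
     {formal_sum [(x, y, c *s z)] - free_scale c (formal_sum [(x, y, z)]) | c x y z. True}"

definition tensor_eq2 :: "('v \<times> 'v) list \<Rightarrow> ('v \<times> 'v) list \<Rightarrow> bool"  (infix \<open>\<approx>\<^sub>2\<close> 50) where
  "s \<approx>\<^sub>2 t \<longleftrightarrow> formal_sum s - formal_sum t \<in> free.span bilinear_relations"

definition tensor_eq3 :: "('v \<times> 'v \<times> 'v) list \<Rightarrow> ('v \<times> 'v \<times> 'v) list \<Rightarrow> bool"  (infix \<open>\<approx>\<^sub>3\<close> 50) where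
  "s \<approx>\<^sub>3 t \<longleftrightarrow> formal_sum s - formal_sum t \<in> free.span trilinear_relations"

definition is_direct_sum :: "'v set set \<Rightarrow> bool" where
  "is_direct_sum \<C> \<longleftrightarrow>
     (\<forall>C\<in>\<C>. subspace C) \<and> span (\<Union>\<C>) = UNIV \<and> (\<forall>C\<in>\<C>. C \<inter> span (\<Union>(\<C> - {C})) = {0})"

end


section \<open>Coalgebras\<close>

text \<open>
  The comultiplication is given in Sweedler notation: the list \<open>\<Delta> x\<close> is a representation
  \<open>\<Sum> x\<^sub>1 \<otimes> x\<^sub>2\<close> of the tensor that is the actual value of the comultiplication at \<open>x\<close>. All axioms
  on \<open>\<Delta>\<close> are therefore imposed up to equality of tensors.
\<close>

locale coalgebra = tensor_space scale
  for scale :: "'k::field \<Rightarrow> 'h::ab_group_add \<Rightarrow> 'h"  (infixr \<open>*s\<close> 75) +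
  fixes \<Delta> :: "'h \<Rightarrow> ('h \<times> 'h) list"
    and \<epsilon> :: "'h \<Rightarrow> 'k"
  assumes comult_add: "\<Delta> (x + y) \<approx>\<^sub>2 \<Delta> x @ \<Delta> y"
    and comult_scale: "\<Delta> (c *s x) \<approx>\<^sub>2 [(c *s x\<^sub>1, x\<^sub>2). (x\<^sub>1, x\<^sub>2) \<leftarrow> \<Delta> x]"
    and counit_linear: "Vector_Spaces.linear (*s) (*) \<epsilon>"
    and coassoc: "[(x\<^sub>1\<^sub>1, x\<^sub>1\<^sub>2, x\<^sub>2). (x\<^sub>1, x\<^sub>2) \<leftarrow> \<Delta> x, (x\<^sub>1\<^sub>1, x\<^sub>1\<^sub>2) \<leftarrow> \<Delta> x\<^sub>1] \<approx>\<^sub>3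
                  [(x\<^sub>1, x\<^sub>2\<^sub>1, x\<^sub>2\<^sub>2). (x\<^sub>1, x\<^sub>2) \<leftarrow> \<Delta> x, (x\<^sub>2\<^sub>1, x\<^sub>2\<^sub>2) \<leftarrow> \<Delta> x\<^sub>2]"
    and counit_left: "(\<Sum>(x\<^sub>1, x\<^sub>2) \<leftarrow> \<Delta> x. \<epsilon> x\<^sub>1 *s x\<^sub>2) = x"
    and counit_right: "(\<Sum>(x\<^sub>1, x\<^sub>2) \<leftarrow> \<Delta> x. \<epsilon> x\<^sub>2 *s x\<^sub>1) = x"
begin

text \<open>\<open>\<Delta>(C) \<subseteq> C \<otimes> C\<close>, where \<open>C \<otimes> C\<close> is viewed inside the tensor square of the whole space.\<close>

definition subcoalgebra :: "'h set \<Rightarrow> bool" where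
  "subcoalgebra C \<longleftrightarrow> subspace C \<and> (\<forall>x\<in>C. \<exists>t. set t \<subseteq> C \<times> C \<and> \<Delta> x \<approx>\<^sub>2 t)"

definition simple_subcoalgebra :: "'h set \<Rightarrow> bool" where
  "simple_subcoalgebra C \<longleftrightarrow>
     subcoalgebra C \<and> C \<noteq> {0} \<and> (\<forall>D. subcoalgebra D \<and> D \<subseteq> C \<longrightarrow> D = {0} \<or> D = C)"

definition cosemisimple :: bool where
  "cosemisimple \<longleftrightarrow> (\<exists>\<C>. (\<forall>C\<in>\<C>. simple_subcoalgebra C) \<and> is_direct_sum \<C>)"

definition convolution :: "('h \<Rightarrow> 'k) \<Rightarrow> ('h \<Rightarrow> 'k) \<Rightarrow> 'h \<Rightarrow> 'k" where
  "convolution c d x = (\<Sum>(x\<^sub>1, x\<^sub>2) \<leftarrow> \<Delta> x. c x\<^sub>1 * d x\<^sub>2)"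

definition dual_algebra :: "('h \<Rightarrow> 'k) ring" where
  "dual_algebra =
     \<lparr>carrier = {c. Vector_Spaces.linear (*s) (*) c},
      monoid.mult = convolution, one = \<epsilon>,
      ring.zero = (\<lambda>x. 0), add = (\<lambda>c d x. c x + d x)\<rparr>"

definition left_act :: "('h \<Rightarrow> 'k) \<Rightarrow> 'h \<Rightarrow> 'h"  (infixr \<open>\<rightharpoonup>\<close> 76) where
  "c \<rightharpoonup> x = (\<Sum>(x\<^sub>1, x\<^sub>2) \<leftarrow> \<Delta> x. c x\<^sub>2 *s x\<^sub>1)"

definition right_act :: "'h \<Rightarrow> ('h \<Rightarrow> 'k) \<Rightarrow> 'h"  (infixl \<open>\<leftharpoonup>\<close> 76) where
  "x \<leftharpoonup> c = (\<Sum>(x\<^sub>1, x\<^sub>2) \<leftarrow> \<Delta> x. c x\<^sub>1 *s x\<^sub>2)"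

end


section \<open>Hopf algebras\<close>

locale hopf_algebra = coalgebra scale \<Delta> \<epsilon>
  for scale :: "'k::field \<Rightarrow> 'h::ring_1 \<Rightarrow> 'h"  (infixr \<open>*s\<close> 75)
    and \<Delta> :: "'h \<Rightarrow> ('h \<times> 'h) list"
    and \<epsilon> :: "'h \<Rightarrow> 'k" +
  fixes S :: "'h \<Rightarrow> 'h"
  assumes scale_mult_left: "(c *s x) * y = c *s (x * y)"
    and scale_mult_right: "x * (c *s y) = c *s (x * y)"
    and comult_mult: "\<Delta> (x * y) \<approx>\<^sub>2 [(x\<^sub>1 * y\<^sub>1, x\<^sub>2 * y\<^sub>2). (x\<^sub>1, x\<^sub>2) \<leftarrow> \<Delta> x, (y\<^sub>1, y\<^sub>2) \<leftarrow> \<Delta> y]"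
    and comult_one: "\<Delta> 1 \<approx>\<^sub>2 [(1, 1)]"
    and counit_mult: "\<epsilon> (x * y) = \<epsilon> x * \<epsilon> y"
    and counit_one: "\<epsilon> 1 = 1"
    and antipode_linear: "Vector_Spaces.linear (*s) (*s) S"
    and antipode_left: "(\<Sum>(x\<^sub>1, x\<^sub>2) \<leftarrow> \<Delta> x. S x\<^sub>1 * x\<^sub>2) = \<epsilon> x *s 1"
    and antipode_right: "(\<Sum>(x\<^sub>1, x\<^sub>2) \<leftarrow> \<Delta> x. x\<^sub>1 * S x\<^sub>2) = \<epsilon> x *s 1"

end

theory Submission
  imports Defs
begin

text \<open>
  The idea is to compare a Frobenius form on \<open>H\<close> that has \<open>S\<^sup>2\<close> as its Nakayama automorphism
  with a symmetric one; the element of \<open>H\<^sup>*\<close> by which they differ is the required \<open>u\<close>.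

  Cosemisimplicity provides an integral \<open>\<mu>\<close> with \<open>\<mu> 1 = 1\<close>, namely the projection of \<open>H\<close> onto
  the simple subcoalgebra \<open>k 1\<close>. The form \<open>b(x, y) = \<mu> (x * S y)\<close> is balanced, that is,
  \<open>x\<^sub>1 b(x\<^sub>2, y) = b(x, y\<^sub>1) y\<^sub>2\<close> (\<open>integral_balanced\<close>), and \<open>\<mu> \<circ> S = \<mu>\<close> yields
  \<open>b(x, y) = b(S\<^sup>2 y, x)\<close> (\<open>integral_nakayama\<close>). It is nondegenerate: the elements \<open>z\<close> with
  \<open>\<mu> (H z) = 0\<close> form a left ideal \<open>J\<close> with \<open>\<Delta> J \<subseteq> H \<otimes> J\<close>, so that
  \<open>\<epsilon> z 1 = S(z\<^sub>1) z\<^sub>2\<close> lies in \<open>J\<close> for \<open>z\<close> in \<open>J\<close>; applying \<open>\<mu>\<close> gives \<open>\<epsilon> z = 0\<close>, and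
  hence \<open>J = 0\<close> (\<open>integral_faithful\<close>). The same fact shows that \<open>S\<close> is injective.

  Every simple subcoalgebra \<open>C\<close> contains a cocommutative element \<open>t \<noteq> 0\<close>
  (\<open>cocommutative_exists\<close>); it corresponds to a nonzero trace on the simple algebra \<open>C\<^sup>*\<close>. Let
  \<open>v\<close> be the linear form on \<open>H\<close> that equals \<open>b(-, t)\<close> on each \<open>C\<close>. Balancedness, the Nakayama
  property and cocommutativity of \<open>t\<close> together say that \<open>S\<^sup>2 (v \<rightharpoonup> x) = x \<leftharpoonup> v\<close>
  (\<open>cocommutative_twist\<close>). Consequently the kernels of \<open>x \<mapsto> v \<rightharpoonup> x\<close> and \<open>x \<mapsto> x \<leftharpoonup> v\<close> coincide, so
  this common kernel is stable under \<open>H\<^sup>*\<close> from both sides; since \<open>v\<close> vanishes on no simple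
  subcoalgebra, it acts injectively, hence is invertible in \<open>H\<^sup>*\<close>. Substituting
  \<open>x = v\<^sup>-\<^sup>1 \<rightharpoonup> h\<close> gives the theorem with \<open>u = v\<close>.

  The trace on \<open>C\<^sup>*\<close> must be nonzero over every field, and the trace of the regular representation
  may vanish in positive characteristic. Extension of scalars is avoided as follows. The operators
  \<open>x \<mapsto> (c \<rightharpoonup> x) \<leftharpoonup> d\<close> span an irreducible algebra \<open>M\<close> on \<open>C\<close>, and its commutant \<open>K\<close> is commutative.
  Jacobson density gives \<open>p \<in> M\<close> that projects onto a \<open>K\<close>-line, together with a decomposition
  \<open>1 = \<Sum> m\<^sub>i p n\<^sub>i\<close>. The corner \<open>p M p\<close> acts on a \<open>K\<close>-line, so it is commutative, and
  \<open>T \<mapsto> \<Sum> p n\<^sub>i T m\<^sub>i p\<close> is a trace on \<open>M\<close> with value \<open>p\<close> at \<open>p\<close> (\<open>trace_exists\<close>).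

  Tensors enter only through the scalars \<open>\<Sum> \<beta>(x\<^sub>1, x\<^sub>2)\<close> for bilinear forms \<open>\<beta>\<close>, and equalities in
  \<open>H\<close> are tested on linear forms. Bilinear forms separate tensors, so nothing is lost.
\<close>

section \<open>Linear forms\<close>

lemma vector_space_field: "vector_space ((*) :: 'k::field \<Rightarrow> 'k \<Rightarrow> 'k)"
  by unfold_locales (simp_all add: algebra_simps)

locale linear_forms = vector_space scale
  for scale :: "'k::field \<Rightarrow> 'v::ab_group_add \<Rightarrow> 'v"  (infixr \<open>*s\<close> 75)
begin

abbreviation linear_form :: "('v \<Rightarrow> 'k) \<Rightarrow> bool" where
  "linear_form \<equiv> Vector_Spaces.linear scale (*)"

abbreviation linear_op :: "('v \<Rightarrow> 'v) \<Rightarrow> bool" where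
  "linear_op \<equiv> Vector_Spaces.linear scale scale"

lemma linear_form_iff:
  "linear_form c \<longleftrightarrow> (\<forall>x y. c (x + y) = c x + c y) \<and> (\<forall>a x. c (a *s x) = a * c x)"
  using vector_space_axioms vector_space_field[where 'k = 'k] by (simp add: Vector_Spaces.linear_iff)

lemma linear_op_iff:
  "linear_op g \<longleftrightarrow> (\<forall>x y. g (x + y) = g x + g y) \<and> (\<forall>a x. g (a *s x) = a *s g x)"
  using vector_space_axioms by (simp add: Vector_Spaces.linear_iff)

lemma linear_formI:
  "(\<And>x y. c (x + y) = c x + c y) \<Longrightarrow> (\<And>a x. c (a *s x) = a * c x) \<Longrightarrow> linear_form c"
  by (simp add: linear_form_iff)

lemma linear_opI:
  "(\<And>x y. g (x + y) = g x + g y) \<Longrightarrow> (\<And>a x. g (a *s x) = a *s g x) \<Longrightarrow> linear_op g"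
  by (simp add: linear_op_iff)

lemma linear_form_add: "linear_form c \<Longrightarrow> c (x + y) = c x + c y"
  and linear_form_scale: "linear_form c \<Longrightarrow> c (a *s x) = a * c x"
  by (simp_all add: linear_form_iff)

lemma linear_op_add: "linear_op g \<Longrightarrow> g (x + y) = g x + g y"
  and linear_op_scale: "linear_op g \<Longrightarrow> g (a *s x) = a *s g x"
  by (simp_all add: linear_op_iff)

lemma linear_form_zero: "linear_form c \<Longrightarrow> c 0 = 0"
  using linear_form_scale[of c 0 0] by simp

lemma linear_op_zero: "linear_op g \<Longrightarrow> g 0 = 0"
  using linear_op_scale[of g 0 0] by simp

lemma linear_form_diff: "linear_form c \<Longrightarrow> c (x - y) = c x - c y"
  using linear_form_add[of c "x - y" y] by simp

lemma linear_op_diff: "linear_op g \<Longrightarrow> g (x - y) = g x - g y"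
  using linear_op_add[of g "x - y" y] by simp

lemma linear_form_sum_list:
  "linear_form c \<Longrightarrow> c (\<Sum>t\<leftarrow>ts. f t) = (\<Sum>t\<leftarrow>ts. c (f t))"
  by (induction ts) (simp_all add: linear_form_zero linear_form_add)

lemma linear_op_sum_list:
  "linear_op g \<Longrightarrow> g (\<Sum>t\<leftarrow>ts. f t) = (\<Sum>t\<leftarrow>ts. g (f t))"
  by (induction ts) (simp_all add: linear_op_zero linear_op_add)

lemma linear_form_comp: "linear_form c \<Longrightarrow> linear_op g \<Longrightarrow> linear_form (\<lambda>x. c (g x))"
  by (simp add: linear_form_iff linear_op_iff)

lemma linear_form_eq_on_span:
  assumes "linear_form c" "linear_form d" "\<And>x. x \<in> B \<Longrightarrow> c x = d x" "x \<in> span B"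
  shows "c x = d x"
proof -
  have "subspace {x. c x = d x}"
    using assms(1,2) by (auto intro!: subspaceI simp: linear_form_zero linear_form_add linear_form_scale)
  then have "span B \<subseteq> {x. c x = d x}"
    using assms(3) by (intro span_minimal) auto
  then show ?thesis using assms(4) by auto
qed

lemma linear_form_extend_independent:
  assumes "independent B"
  shows "\<exists>g. linear_form g \<and> (\<forall>x\<in>B. g x = f x)"
proof -
  interpret vector_space_pair scale "(*) :: 'k \<Rightarrow> 'k \<Rightarrow> 'k"
    by (intro vector_space_pair.intro vector_space_axioms vector_space_field)
  show ?thesis using linear_independent_extend[OF assms] by blast
qed

lemma linear_form_extend:
  assumes V: "subspace V"
    and add: "\<And>x y. x \<in> V \<Longrightarrow> y \<in> V \<Longrightarrow> f (x + y) = f x + f y"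
    and scal: "\<And>a x. x \<in> V \<Longrightarrow> f (a *s x) = a * f x"
  shows "\<exists>g. linear_form g \<and> (\<forall>x\<in>V. g x = f x)"
proof -
  obtain B where B: "B \<subseteq> V" "independent B" "V \<subseteq> span B"
    using maximal_independent_subset by blast
  obtain g where g: "linear_form g" "\<forall>x\<in>B. g x = f x"
    using linear_form_extend_independent[OF B(2)] by blast
  have "subspace {x \<in> V. g x = f x}"
    using V g(1) add scal subspace_0[OF V] scal[of 0 0]
    by (auto intro!: subspaceI simp: linear_form_zero linear_form_add linear_form_scale
        subspace_add subspace_scale)
  then have "span B \<subseteq> {x \<in> V. g x = f x}"
    using B g by (intro span_minimal) auto
  then show ?thesis using B g by blast
qed

lemma linear_form_separating:
  assumes V: "subspace V" and x: "x \<notin> V"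
  shows "\<exists>g. linear_form g \<and> (\<forall>y\<in>V. g y = 0) \<and> g x = 1"
proof -
  obtain B where B: "B \<subseteq> V" "independent B" "V \<subseteq> span B"
    using maximal_independent_subset by blast
  have "span B \<subseteq> V" using B V by (intro span_minimal)
  then have xB: "x \<notin> span B" using x by auto
  then have ind: "independent (insert x B)" using B by (intro independent_insertI)
  obtain g where g: "linear_form g" "\<forall>y\<in>insert x B. g y = (if y = x then 1 else 0)"
    using linear_form_extend_independent[OF ind, of "\<lambda>y. if y = x then 1 else 0"] by blast
  have "g y = 0" if "y \<in> V" for y
  proof (rule linear_form_eq_on_span[OF g(1), of "\<lambda>_. 0"])
    show "linear_form (\<lambda>_. 0)" by (rule linear_formI) auto
    show "g z = 0" if "z \<in> B" for z using that g(2) xB span_base by auto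
    show "y \<in> span B" using that B by auto
  qed
  then show ?thesis using g by auto
qed

lemma linear_forms_eqI:
  assumes "\<And>c. linear_form c \<Longrightarrow> c x = c y"
  shows "x = y"
proof (rule ccontr)
  assume "x \<noteq> y"
  then obtain g where "linear_form g" "g (x - y) = 1"
    using linear_form_separating[OF subspace_single_0, of "x - y"] by auto
  then show False using assms[of g] by (simp add: linear_form_diff)
qed

text \<open>Finitely many vectors involve only finitely many elements of a basis. This is what turns a
  bilinear form, evaluated on a list of pairs, into a finite sum of products of linear forms.\<close>

lemma finite_coordinates:
  assumes "finite X"
  obtains F r where "finite F" "\<And>b. linear_form (r b)"
    "\<And>x. x \<in> X \<Longrightarrow> x = (\<Sum>b\<in>F. (r b x) *s b)"
proof -
  define B where "B = extend_basis {}"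
  have B: "independent B" "span B = UNIV"
    unfolding B_def by (auto simp: independent_extend_basis independent_empty)
  define r where "r b x = representation B x b" for b x
  define F where "F = (\<Union>x\<in>X. {b. representation B x b \<noteq> 0})"
  have 1: "finite F" unfolding F_def using assms finite_representation by auto
  have 2: "linear_form (r b)" for b
    unfolding r_def using B
    by (intro linear_formI) (simp_all add: representation_add representation_scale)
  have 3: "x = (\<Sum>b\<in>F. (r b x) *s b)" if "x \<in> X" for x
  proof -
    have "x = (\<Sum>b | representation B x b \<noteq> 0. (representation B x b) *s b)"
      using B by (simp add: sum_nonzero_representation_eq)
    also have "\<dots> = (\<Sum>b\<in>F. (r b x) *s b)"
      unfolding r_def using that 1 by (intro sum.mono_neutral_left) (auto simp: F_def)
    finally show ?thesis .
  qed
  show thesis using 1 2 3 that by blast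
qed

end

section \<open>Tensors\<close>

sublocale tensor_space \<subseteq> linear_forms ..

text \<open>The linear extension of \<open>f\<close> to the free vector space.\<close>

definition free_eval :: "('x \<Rightarrow> 'k::field) \<Rightarrow> ('x \<Rightarrow>\<^sub>0 'k) \<Rightarrow> 'k" where
  "free_eval f p = (\<Sum>x\<in>Poly_Mapping.keys p. Poly_Mapping.lookup p x * f x)"

lemma free_eval_superset:
  assumes "finite A" "Poly_Mapping.keys p \<subseteq> A"
  shows "free_eval f p = (\<Sum>x\<in>A. Poly_Mapping.lookup p x * f x)"
  unfolding free_eval_def using assms
  by (intro sum.mono_neutral_left) (auto simp: in_keys_iff)

lemma free_eval_add: "free_eval f (p + q) = free_eval f p + free_eval f q"
proof -
  let ?A = "Poly_Mapping.keys p \<union> Poly_Mapping.keys q"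
  have "free_eval f r = (\<Sum>x\<in>?A. Poly_Mapping.lookup r x * f x)" if "r \<in> {p + q, p, q}" for r
    using that keys_add[of p q] by (intro free_eval_superset) auto
  then show ?thesis
    by (simp add: Poly_Mapping.lookup_add algebra_simps sum.distrib)
qed

lemma free_eval_scale: "free_eval f (free_scale c p) = c * free_eval f p"
proof -
  have "Poly_Mapping.keys (free_scale c p) \<subseteq> Poly_Mapping.keys p"
    by (auto simp: in_keys_iff)
  then show ?thesis
    by (simp add: free_eval_superset[of "Poly_Mapping.keys p"] sum_distrib_left mult.assoc)
qed

lemma free_eval_diff: "free_eval f (p - q) = free_eval f p - free_eval f q"
  using free_eval_add[of f "p - q" q] by simp

lemma free_eval_zero: "free_eval f 0 = 0"
  by (simp add: free_eval_def)

lemma free_eval_formal_sum: "free_eval f (formal_sum ts) = (\<Sum>t\<leftarrow>ts. f t)"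
  by (induction ts) (simp_all add: formal_sum_def free_eval_zero free_eval_add,
      simp add: free_eval_def)

lemma free_eval_eq_0_on_span:
  assumes "\<And>r. r \<in> R \<Longrightarrow> free_eval f r = 0" "p \<in> free.span R"
  shows "free_eval f p = 0"
proof -
  have "free.subspace {p. free_eval f p = 0}"
    by (rule free.subspaceI) (auto simp: free_eval_zero free_eval_add free_eval_scale)
  then have "free.span R \<subseteq> {p. free_eval f p = 0}"
    using assms(1) by (intro free.span_minimal) auto
  then show ?thesis using assms(2) by auto
qed

context tensor_space
begin

definition bilinear_form :: "('v \<Rightarrow> 'v \<Rightarrow> 'k) \<Rightarrow> bool" where
  "bilinear_form \<beta> \<longleftrightarrow> (\<forall>y. linear_form (\<lambda>x. \<beta> x y)) \<and> (\<forall>x. linear_form (\<beta> x))"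

definition trilinear_form :: "('v \<Rightarrow> 'v \<Rightarrow> 'v \<Rightarrow> 'k) \<Rightarrow> bool" where
  "trilinear_form \<tau> \<longleftrightarrow>
     (\<forall>y z. linear_form (\<lambda>x. \<tau> x y z)) \<and> (\<forall>x z. linear_form (\<lambda>y. \<tau> x y z)) \<and>
     (\<forall>x y. linear_form (\<tau> x y))"

lemma bilinear_formI:
  "(\<And>y. linear_form (\<lambda>x. \<beta> x y)) \<Longrightarrow> (\<And>x. linear_form (\<lambda>y. \<beta> x y)) \<Longrightarrow> bilinear_form \<beta>"
  by (simp add: bilinear_form_def)

lemma bilinear_form_left: "bilinear_form \<beta> \<Longrightarrow> linear_form (\<lambda>x. \<beta> x y)"
  and bilinear_form_right: "bilinear_form \<beta> \<Longrightarrow> linear_form (\<beta> x)"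
  by (simp_all add: bilinear_form_def)

lemma trilinear_formI:
  "(\<And>y z. linear_form (\<lambda>x. \<tau> x y z)) \<Longrightarrow> (\<And>x z. linear_form (\<lambda>y. \<tau> x y z)) \<Longrightarrow>
   (\<And>x y. linear_form (\<lambda>z. \<tau> x y z)) \<Longrightarrow> trilinear_form \<tau>"
  by (simp add: trilinear_form_def)

text \<open>The linear extension of a multilinear form to the free vector space kills the relations that
  define the tensor product.\<close>

lemma tensor_eq2_bilinear:
  assumes "s \<approx>\<^sub>2 t" "bilinear_form \<beta>"
  shows "(\<Sum>(x, y)\<leftarrow>s. \<beta> x y) = (\<Sum>(x, y)\<leftarrow>t. \<beta> x y)"
proof -
  have "free_eval (\<lambda>(x, y). \<beta> x y) (formal_sum s - formal_sum t) = 0"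
  proof (rule free_eval_eq_0_on_span)
    show "formal_sum s - formal_sum t \<in> free.span bilinear_relations"
      using assms(1) by (simp add: tensor_eq2_def)
    show "free_eval (\<lambda>(x, y). \<beta> x y) r = 0" if "r \<in> bilinear_relations" for r
      using that assms(2) unfolding bilinear_relations_def
      by (auto simp: free_eval_diff free_eval_scale free_eval_formal_sum bilinear_form_def
          linear_form_iff)
  qed
  then show ?thesis by (simp add: free_eval_diff free_eval_formal_sum)
qed

lemma tensor_eq3_trilinear:
  assumes "s \<approx>\<^sub>3 t" "trilinear_form \<tau>"
  shows "(\<Sum>(x, y, z)\<leftarrow>s. \<tau> x y z) = (\<Sum>(x, y, z)\<leftarrow>t. \<tau> x y z)"
proof -
  have "free_eval (\<lambda>(x, y, z). \<tau> x y z) (formal_sum s - formal_sum t) = 0"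
  proof (rule free_eval_eq_0_on_span)
    show "formal_sum s - formal_sum t \<in> free.span trilinear_relations"
      using assms(1) by (simp add: tensor_eq3_def)
    show "free_eval (\<lambda>(x, y, z). \<tau> x y z) r = 0" if "r \<in> trilinear_relations" for r
      using that assms(2) unfolding trilinear_relations_def
      by (auto simp: free_eval_diff free_eval_scale free_eval_formal_sum trilinear_form_def
          linear_form_iff)
  qed
  then show ?thesis by (simp add: free_eval_diff free_eval_formal_sum)
qed

text \<open>Bilinear forms separate tensors: a formal sum outside the span of the relations is detected by a
  linear form on the free vector space that vanishes on the relations, and such a form restricts to
  a bilinear form on the generators.\<close>

lemma tensor_eq2I:
  assumes "\<And>\<beta>. bilinear_form \<beta> \<Longrightarrow> (\<Sum>(x, y)\<leftarrow>s. \<beta> x y) = (\<Sum>(x, y)\<leftarrow>t. \<beta> x y)"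
  shows "s \<approx>\<^sub>2 t"
proof (rule ccontr)
  assume "\<not> s \<approx>\<^sub>2 t"
  interpret ff: linear_forms "free_scale :: 'k \<Rightarrow> ('v \<times> 'v \<Rightarrow>\<^sub>0 'k) \<Rightarrow> ('v \<times> 'v \<Rightarrow>\<^sub>0 'k)" ..
  from \<open>\<not> s \<approx>\<^sub>2 t\<close> obtain \<phi> where \<phi>: "ff.linear_form \<phi>" "\<forall>r\<in>free.span bilinear_relations. \<phi> r = 0"
      "\<phi> (formal_sum s - formal_sum t) = 1"
    using ff.linear_form_separating[OF free.subspace_span] unfolding tensor_eq2_def by blast
  define \<beta> where "\<beta> x y = \<phi> (formal_sum [(x, y)])" for x y
  have rel: "\<phi> r = 0" if "r \<in> bilinear_relations" for r
    using that \<phi>(2) free.span_base by blast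
  have split: "\<phi> (formal_sum [u, v]) = \<phi> (formal_sum [u]) + \<phi> (formal_sum [v])" for u v
    using \<phi>(1) by (simp add: formal_sum_def ff.linear_form_add)
  have "bilinear_form \<beta>"
  proof (intro bilinear_formI linear_formI)
    fix x x' y
    have "formal_sum [(x + x', y)] - formal_sum [(x, y), (x', y)] \<in> bilinear_relations"
      unfolding bilinear_relations_def by blast
    from rel[OF this] show "\<beta> (x + x') y = \<beta> x y + \<beta> x' y"
      using \<phi>(1) by (simp add: \<beta>_def ff.linear_form_diff split)
  next
    fix x y y'
    have "formal_sum [(x, y + y')] - formal_sum [(x, y), (x, y')] \<in> bilinear_relations"
      unfolding bilinear_relations_def by blast
    from rel[OF this] show "\<beta> x (y + y') = \<beta> x y + \<beta> x y'"
      using \<phi>(1) by (simp add: \<beta>_def ff.linear_form_diff split)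
  next
    fix c x y
    have "formal_sum [(c *s x, y)] - free_scale c (formal_sum [(x, y)]) \<in> bilinear_relations"
      unfolding bilinear_relations_def by blast
    from rel[OF this] show "\<beta> (c *s x) y = c * \<beta> x y"
      using \<phi>(1) by (simp add: \<beta>_def ff.linear_form_diff ff.linear_form_scale)
  next
    fix c x y
    have "formal_sum [(x, c *s y)] - free_scale c (formal_sum [(x, y)]) \<in> bilinear_relations"
      unfolding bilinear_relations_def by blast
    from rel[OF this] show "\<beta> x (c *s y) = c * \<beta> x y"
      using \<phi>(1) by (simp add: \<beta>_def ff.linear_form_diff ff.linear_form_scale)
  qed
  moreover have "\<phi> (formal_sum l) = (\<Sum>(x, y)\<leftarrow>l. \<beta> x y)" for l
  proof (induction l)
    case Nil
    show ?case using \<phi>(1) by (simp add: formal_sum_def ff.linear_form_zero)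
  next
    case (Cons u l)
    have "formal_sum (u # l) = formal_sum [u] + formal_sum l" by (simp add: formal_sum_def)
    then have "\<phi> (formal_sum (u # l)) = \<phi> (formal_sum [u]) + \<phi> (formal_sum l)"
      using \<phi>(1) by (metis ff.linear_form_add)
    then show ?case using Cons by (simp add: \<beta>_def split: prod.split)
  qed
  ultimately show False using assms[of \<beta>] \<phi> by (simp add: ff.linear_form_diff)
qed

text \<open>Expanding the left arguments in a basis writes \<open>\<beta>\<close> on the given list as a finite sum of
  products \<open>c \<otimes> \<beta> y\<close>. This decouples the two arguments of \<open>\<beta>\<close>, which is how identities known for
  products of linear forms are transferred to forms like \<open>\<mu> (S a * b)\<close>.\<close>

lemma bilinear_sum_eq_0:
  assumes "bilinear_form \<beta>"
    and zero: "\<And>c y. linear_form c \<Longrightarrow> (\<Sum>(a, b)\<leftarrow>s. c a * \<beta> y b) = 0"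
  shows "(\<Sum>(a, b)\<leftarrow>s. \<beta> a b) = 0"
proof -
  obtain F r where F: "finite F" "\<And>b. linear_form (r b)"
    and x: "\<And>x. x \<in> fst ` set s \<Longrightarrow> x = (\<Sum>b\<in>F. (r b x) *s b)"
    using finite_coordinates[of "fst ` set s"] by blast
  have expand: "\<beta> a b = (\<Sum>f\<in>F. r f a * \<beta> f b)" if "(a, b) \<in> set s" for a b
  proof -
    have *: "linear_form (\<lambda>a. \<beta> a b)" using assms(1) by (rule bilinear_form_left)
    have "\<beta> (\<Sum>f\<in>G. (r f a) *s f) b = (\<Sum>f\<in>G. r f a * \<beta> f b)" if "finite G" for G
      using that
      by (induction G) (simp_all add: linear_form_zero[OF *] linear_form_add[OF *]
          linear_form_scale[OF *])
    moreover have "a = (\<Sum>f\<in>F. (r f a) *s f)" using x that by force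
    ultimately show ?thesis using F(1) by metis
  qed
  have "(\<Sum>(a, b)\<leftarrow>s. \<beta> a b) = (\<Sum>(a, b)\<leftarrow>s. \<Sum>f\<in>F. r f a * \<beta> f b)"
    using expand by (intro arg_cong[where f = sum_list] map_cong) auto
  also have "\<dots> = (\<Sum>f\<in>F. \<Sum>(a, b)\<leftarrow>s. r f a * \<beta> f b)"
    by (induction s) (auto simp: sum.distrib)
  also have "\<dots> = 0" using zero F(2) by simp
  finally show ?thesis .
qed

text \<open>Bases of the summands are disjoint and unite to a basis of the whole space, so values may be
  prescribed on each summand separately.\<close>

lemma linear_form_glue:
  assumes ds: "is_direct_sum \<C>" and f: "\<And>C. C \<in> \<C> \<Longrightarrow> linear_form (f C)"
  shows "\<exists>g. linear_form g \<and> (\<forall>C\<in>\<C>. \<forall>x\<in>C. g x = f C x)"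
proof -
  have sub: "subspace C" if "C \<in> \<C>" for C using ds that by (simp add: is_direct_sum_def)
  have int: "C \<inter> span (\<Union>(\<C> - {C})) = {0}" if "C \<in> \<C>" for C
    using ds that by (simp add: is_direct_sum_def)
  have "\<forall>C\<in>\<C>. \<exists>B. B \<subseteq> C \<and> independent B \<and> C \<subseteq> span B"
    using maximal_independent_subset by metis
  then obtain B where B: "\<And>C. C \<in> \<C> \<Longrightarrow> B C \<subseteq> C \<and> independent (B C) \<and> C \<subseteq> span (B C)"
    by metis
  have ind: "independent (\<Union>C\<in>\<C>. B C)"
  proof
    assume "dependent (\<Union>C\<in>\<C>. B C)"
    then obtain a C where a: "C \<in> \<C>" "a \<in> B C" "a \<in> span ((\<Union>C\<in>\<C>. B C) - {a})"
      by (auto simp: dependent_def)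
    have "(\<Union>C\<in>\<C>. B C) - {a} \<subseteq> (B C - {a}) \<union> \<Union>(\<C> - {C})" using B by blast
    then have "a \<in> span ((B C - {a}) \<union> \<Union>(\<C> - {C}))" using a(3) span_mono by blast
    then obtain x y where xy: "a = x + y" "x \<in> span (B C - {a})" "y \<in> span (\<Union>(\<C> - {C}))"
      by (auto simp: span_Un)
    have "B C - {a} \<subseteq> C" using B[OF a(1)] by auto
    then have "x \<in> C" using xy(2) span_minimal[OF _ sub[OF a(1)]] by blast
    moreover have "a \<in> C" using B[OF a(1)] a(2) by auto
    ultimately have "a - x \<in> C" by (intro subspace_diff sub[OF a(1)])
    then have "y \<in> C" using xy(1) by simp
    then have "y = 0" using int[OF a(1)] xy(3) by blast
    then have "a \<in> span (B C - {a})" using xy by simp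
    then have "dependent (B C)" using a(2) unfolding dependent_def by blast
    then show False using B[OF a(1)] by simp
  qed
  have unique: "D = C" if "b \<in> B C" "b \<in> D" "C \<in> \<C>" "D \<in> \<C>" for b C D
  proof (rule ccontr)
    assume "D \<noteq> C"
    then have "b \<in> span (\<Union>(\<C> - {C}))" using that by (intro span_base) auto
    moreover have "b \<in> C" using that B by blast
    ultimately have "b = 0" using int[OF that(3)] by blast
    then have "dependent (B C)" using that dependent_zero by blast
    then show False using B that by blast
  qed
  obtain g where g: "linear_form g" "\<forall>b\<in>(\<Union>C\<in>\<C>. B C). g b = f (THE C. C \<in> \<C> \<and> b \<in> C) b"
    using linear_form_extend_independent[OF ind, of "\<lambda>b. f (THE C. C \<in> \<C> \<and> b \<in> C) b"] by blast
  have "g x = f C x" if C: "C \<in> \<C>" and "x \<in> C" for C x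
  proof (rule linear_form_eq_on_span[OF g(1) f[OF C]])
    show "x \<in> span (B C)" using that B by blast
    fix b assume b: "b \<in> B C"
    have "(THE D. D \<in> \<C> \<and> b \<in> D) = C"
      using b C B unique by (intro the_equality) blast+
    then show "g b = f C b" using g(2) b C by auto
  qed
  then show ?thesis using g(1) by blast
qed

end

section \<open>Sweedler calculus\<close>

context linear_forms
begin

lemma linear_form_const_0: "linear_form (\<lambda>x. 0)"
  and linear_form_cmult: "linear_form c \<Longrightarrow> linear_form (\<lambda>x. a * c x)"
  and linear_form_multc: "linear_form c \<Longrightarrow> linear_form (\<lambda>x. c x * a)"
  by (simp_all add: linear_form_iff algebra_simps)

lemma linear_op_id: "linear_op (\<lambda>x. x)"
  and linear_op_plus: "linear_op f \<Longrightarrow> linear_op g \<Longrightarrow> linear_op (\<lambda>x. f x + g x)"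
  and linear_op_comp: "linear_op f \<Longrightarrow> linear_op g \<Longrightarrow> linear_op (\<lambda>x. f (g x))"
  by (simp_all add: linear_op_iff algebra_simps)

lemma linear_op_minus: "linear_op f \<Longrightarrow> linear_op g \<Longrightarrow> linear_op (\<lambda>x. f x - g x)"
  by (simp add: linear_op_iff algebra_simps)

lemma linear_opI_forms:
  assumes "\<And>c. linear_form c \<Longrightarrow> linear_form (\<lambda>x. c (f x))"
  shows "linear_op f"
proof (rule linear_opI)
  show "f (x + y) = f x + f y" for x y
    by (intro linear_forms_eqI) (simp add: linear_form_add linear_form_add[OF assms])
  show "f (a *s x) = a *s f x" for a x
    by (intro linear_forms_eqI) (simp add: linear_form_scale linear_form_scale[OF assms])
qed

end

lemma sum_list_concat_map:
  fixes g :: "'a \<Rightarrow> 'b::monoid_add list"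
  shows "sum_list (concat (map g xs)) = (\<Sum>x\<leftarrow>xs. sum_list (g x))"
  by (induction xs) auto

lemma sum_list_swap:
  fixes f :: "'a \<Rightarrow> 'b \<Rightarrow> 'c::comm_monoid_add"
  shows "(\<Sum>s\<leftarrow>xs. \<Sum>t\<leftarrow>ys. f s t) = (\<Sum>t\<leftarrow>ys. \<Sum>s\<leftarrow>xs. f s t)"
  by (induction xs) (simp_all add: sum_list_addf)

context coalgebra
begin

text \<open>\<open>\<Sum> \<beta>(x\<^sub>1, x\<^sub>2)\<close> in Sweedler notation. The coefficients are scalars so that one operator serves
  for all computations; for bilinear \<open>\<beta>\<close> the value depends only on the tensor that \<open>\<Delta> x\<close> represents.\<close>

definition sweedler :: "'h \<Rightarrow> ('h \<Rightarrow> 'h \<Rightarrow> 'k) \<Rightarrow> 'k" where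
  "sweedler x \<beta> = (\<Sum>(a, b)\<leftarrow>\<Delta> x. \<beta> a b)"

lemma sweedler_const_mult: "sweedler x (\<lambda>a b. r * \<beta> a b) = r * sweedler x \<beta>"
  unfolding sweedler_def by (simp add: sum_list_const_mult case_prod_unfold)

lemma sweedler_mult_const: "sweedler x (\<lambda>a b. \<beta> a b * r) = sweedler x \<beta> * r"
  using sweedler_const_mult[of x r \<beta>] by (simp add: mult.commute)

lemma sweedler_add: "sweedler x (\<lambda>a b. \<beta> a b + \<gamma> a b) = sweedler x \<beta> + sweedler x \<gamma>"
  unfolding sweedler_def by (simp add: sum_list_addf case_prod_unfold)

lemma sweedler_swap:
  "sweedler x (\<lambda>a b. sweedler y (\<lambda>p q. \<gamma> a b p q)) = sweedler y (\<lambda>p q. sweedler x (\<lambda>a b. \<gamma> a b p q))"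
  unfolding sweedler_def case_prod_unfold by (rule sum_list_swap)

lemma linear_form_sweedler_inner:
  "(\<And>a b. linear_form (\<lambda>x. \<gamma> a b x)) \<Longrightarrow> linear_form (\<lambda>x. sweedler y (\<lambda>a b. \<gamma> a b x))"
  by (simp add: linear_form_iff sweedler_add sweedler_const_mult)

lemma linear_form_sweedler:
  assumes \<beta>: "bilinear_form \<beta>"
  shows "linear_form (\<lambda>x. sweedler x \<beta>)"
proof (rule linear_formI)
  show "sweedler (x + y) \<beta> = sweedler x \<beta> + sweedler y \<beta>" for x y
    unfolding sweedler_def using tensor_eq2_bilinear[OF comult_add \<beta>, of x y] by simp
  show "sweedler (r *s x) \<beta> = r * sweedler x \<beta>" for r x
  proof -
    have "(\<Sum>(a, b)\<leftarrow>concat (map (\<lambda>(a, b). [(r *s a, b)]) xs). \<beta> a b) = r * (\<Sum>(a, b)\<leftarrow>xs. \<beta> a b)" for xs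
      by (induction xs) (auto simp: linear_form_scale[OF bilinear_form_left[OF \<beta>]] algebra_simps)
    then show ?thesis
      unfolding sweedler_def using tensor_eq2_bilinear[OF comult_scale \<beta>, of r x]
      by (simp add: map_concat comp_def case_prod_unfold)
  qed
qed

lemma linear_form_sweedler_comp:
  "linear_op g \<Longrightarrow> bilinear_form \<beta> \<Longrightarrow> linear_form (\<lambda>x. sweedler (g x) \<beta>)"
  using linear_form_comp[OF linear_form_sweedler] .

lemma sweedler_coassoc:
  assumes "trilinear_form \<tau>"
  shows "sweedler x (\<lambda>a b. sweedler a (\<lambda>a\<^sub>1 a\<^sub>2. \<tau> a\<^sub>1 a\<^sub>2 b)) =
         sweedler x (\<lambda>a b. sweedler b (\<lambda>b\<^sub>1 b\<^sub>2. \<tau> a b\<^sub>1 b\<^sub>2))"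
  using tensor_eq3_trilinear[OF coassoc assms, of x]
  unfolding sweedler_def by (simp add: sum_list_concat_map case_prod_unfold map_concat comp_def)

lemma sweedler_counit_left:
  assumes "linear_form c"
  shows "sweedler x (\<lambda>a b. \<epsilon> a * c b) = c x"
proof -
  have "c (\<Sum>(a, b)\<leftarrow>\<Delta> x. \<epsilon> a *s b) = sweedler x (\<lambda>a b. \<epsilon> a * c b)"
    unfolding sweedler_def
    by (simp add: case_prod_unfold linear_form_sum_list[OF assms] linear_form_scale[OF assms])
  then show ?thesis by (simp add: counit_left)
qed

lemma sweedler_counit_right:
  assumes "linear_form c"
  shows "sweedler x (\<lambda>a b. c a * \<epsilon> b) = c x"
proof -
  have "c (\<Sum>(a, b)\<leftarrow>\<Delta> x. \<epsilon> b *s a) = sweedler x (\<lambda>a b. c a * \<epsilon> b)"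
    unfolding sweedler_def
    by (simp add: case_prod_unfold linear_form_sum_list[OF assms] linear_form_scale[OF assms] mult.commute)
  then show ?thesis by (simp add: counit_right)
qed

lemma form_left_act:
  assumes "linear_form c"
  shows "c (d \<rightharpoonup> x) = sweedler x (\<lambda>a b. c a * d b)"
  unfolding left_act_def sweedler_def
  by (simp add: case_prod_unfold linear_form_sum_list[OF assms] linear_form_scale[OF assms] mult.commute)

lemma form_right_act:
  assumes "linear_form c"
  shows "c (x \<leftharpoonup> d) = sweedler x (\<lambda>a b. d a * c b)"
  unfolding right_act_def sweedler_def
  by (simp add: case_prod_unfold linear_form_sum_list[OF assms] linear_form_scale[OF assms])

lemma convolution_sweedler: "convolution c d x = sweedler x (\<lambda>a b. c a * d b)"
  by (simp add: convolution_def sweedler_def)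

lemma bilinear_form_mult:
  "linear_form c \<Longrightarrow> linear_form d \<Longrightarrow> bilinear_form (\<lambda>a b. c a * d b)"
  by (intro bilinear_formI linear_form_cmult linear_form_multc)

lemma linear_op_left_act: "linear_form d \<Longrightarrow> linear_op (\<lambda>x. d \<rightharpoonup> x)"
  by (intro linear_opI_forms) (simp add: form_left_act linear_form_sweedler bilinear_form_mult)

lemma linear_op_right_act: "linear_form d \<Longrightarrow> linear_op (\<lambda>x. x \<leftharpoonup> d)"
  by (intro linear_opI_forms) (simp add: form_right_act linear_form_sweedler bilinear_form_mult)

lemma linear_form_convolution:
  "linear_form c \<Longrightarrow> linear_form d \<Longrightarrow> linear_form (convolution c d)"
  unfolding convolution_sweedler[abs_def] by (intro linear_form_sweedler bilinear_form_mult)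

lemma counit_form: "linear_form \<epsilon>"
  by (rule counit_linear)

lemma counit_left_act: "linear_form c \<Longrightarrow> \<epsilon> (c \<rightharpoonup> x) = c x"
  by (simp add: form_left_act counit_form sweedler_counit_left)

lemma counit_right_act: "linear_form c \<Longrightarrow> \<epsilon> (x \<leftharpoonup> c) = c x"
  by (simp add: form_right_act counit_form sweedler_counit_right)

lemma left_act_counit [simp]: "\<epsilon> \<rightharpoonup> x = x"
  by (rule linear_forms_eqI) (simp add: form_left_act sweedler_counit_right)

lemma right_act_counit [simp]: "x \<leftharpoonup> \<epsilon> = x"
  by (rule linear_forms_eqI) (simp add: form_right_act sweedler_counit_left)

lemma trilinear_form_mult:
  "linear_form c \<Longrightarrow> linear_form d \<Longrightarrow> linear_form e \<Longrightarrow> trilinear_form (\<lambda>x y z. c x * (d y * e z))"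
  by (intro trilinear_formI linear_form_cmult linear_form_multc)

text \<open>Coassociativity in the form that yields both the bimodule axioms for the actions of the dual
  algebra and the associativity of convolution.\<close>

lemma sweedler_coassoc_mult:
  assumes "linear_form c" "linear_form d" "linear_form e"
  shows "sweedler x (\<lambda>a b. c a * sweedler b (\<lambda>p q. d p * e q)) =
         sweedler x (\<lambda>a b. sweedler a (\<lambda>p q. c p * d q) * e b)"
proof -
  have "sweedler x (\<lambda>a b. c a * sweedler b (\<lambda>p q. d p * e q)) =
      sweedler x (\<lambda>a b. sweedler b (\<lambda>p q. c a * (d p * e q)))"
    by (simp add: sweedler_const_mult)
  also have "\<dots> = sweedler x (\<lambda>a b. sweedler a (\<lambda>p q. c p * (d q * e b)))"
    by (rule sweedler_coassoc[OF trilinear_form_mult[OF assms], symmetric])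
  also have "\<dots> = sweedler x (\<lambda>a b. sweedler a (\<lambda>p q. c p * d q) * e b)"
    by (simp add: sweedler_mult_const flip: mult.assoc)
  finally show ?thesis .
qed

lemma left_act_left_act:
  assumes "linear_form c" "linear_form d"
  shows "c \<rightharpoonup> d \<rightharpoonup> x = convolution c d \<rightharpoonup> x"
proof (rule linear_forms_eqI)
  fix e assume e: "linear_form e"
  have "e (c \<rightharpoonup> d \<rightharpoonup> x) = convolution e c (d \<rightharpoonup> x)"
    by (simp add: form_left_act[OF e] convolution_sweedler)
  also have "\<dots> = e (convolution c d \<rightharpoonup> x)"
    using sweedler_coassoc_mult[OF e assms, of x]
    by (simp add: form_left_act[OF linear_form_convolution[OF e assms(1)]] form_left_act[OF e])
      (simp add: convolution_sweedler)
  finally show "e (c \<rightharpoonup> d \<rightharpoonup> x) = e (convolution c d \<rightharpoonup> x)" .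
qed

lemma right_act_right_act:
  assumes "linear_form c" "linear_form d"
  shows "x \<leftharpoonup> c \<leftharpoonup> d = x \<leftharpoonup> convolution c d"
proof (rule linear_forms_eqI)
  fix e assume e: "linear_form e"
  have "e (x \<leftharpoonup> c \<leftharpoonup> d) = convolution d e (x \<leftharpoonup> c)"
    by (simp add: form_right_act[OF e] convolution_sweedler)
  also have "\<dots> = e (x \<leftharpoonup> convolution c d)"
    using sweedler_coassoc_mult[OF assms e, of x]
    by (simp add: form_right_act[OF linear_form_convolution[OF assms(2) e]] form_right_act[OF e])
      (simp add: convolution_sweedler)
  finally show "e (x \<leftharpoonup> c \<leftharpoonup> d) = e (x \<leftharpoonup> convolution c d)" .
qed

lemma left_act_right_act:
  assumes "linear_form c" "linear_form d"
  shows "(c \<rightharpoonup> x) \<leftharpoonup> d = c \<rightharpoonup> (x \<leftharpoonup> d)"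
proof (rule linear_forms_eqI)
  fix e assume e: "linear_form e"
  have "e ((c \<rightharpoonup> x) \<leftharpoonup> d) = convolution d e (c \<rightharpoonup> x)"
    by (simp add: form_right_act[OF e] convolution_sweedler)
  also have "\<dots> = convolution e c (x \<leftharpoonup> d)"
    using sweedler_coassoc_mult[OF assms(2) e assms(1), of x]
    by (simp add: form_left_act[OF linear_form_convolution[OF assms(2) e]]
        form_right_act[OF linear_form_convolution[OF e assms(1)]])
      (simp add: convolution_sweedler)
  also have "\<dots> = e (c \<rightharpoonup> (x \<leftharpoonup> d))"
    by (simp add: form_left_act[OF e] convolution_sweedler)
  finally show "e ((c \<rightharpoonup> x) \<leftharpoonup> d) = e (c \<rightharpoonup> (x \<leftharpoonup> d))" .
qed

lemma convolution_assoc: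
  assumes "linear_form c" "linear_form d" "linear_form e"
  shows "convolution (convolution c d) e = convolution c (convolution d e)"
  using sweedler_coassoc_mult[OF assms] by (auto simp: convolution_sweedler)

lemma dual_algebra_monoid: "monoid dual_algebra"
  unfolding dual_algebra_def
  by (rule monoidI)
    (auto simp: linear_form_convolution convolution_assoc counit_form convolution_sweedler
      sweedler_counit_left sweedler_counit_right)

text \<open>Equivalently, evaluation at \<open>t\<close> is a trace on the dual algebra.\<close>

definition cocommutative :: "'h \<Rightarrow> bool" where
  "cocommutative t \<longleftrightarrow> (\<forall>c d. linear_form c \<longrightarrow> linear_form d \<longrightarrow> convolution c d t = convolution d c t)"

lemma sweedler_eq_0:
  assumes "bilinear_form \<beta>" "\<And>c y. linear_form c \<Longrightarrow> sweedler x (\<lambda>a b. c a * \<beta> y b) = 0"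
  shows "sweedler x \<beta> = 0"
  using bilinear_sum_eq_0[OF assms(1), of "\<Delta> x"] assms(2) by (simp add: sweedler_def)

lemma bilinear_form_flip: "bilinear_form \<beta> \<Longrightarrow> bilinear_form (\<lambda>x y. \<beta> y x)"
  by (simp add: bilinear_form_def)

subsection \<open>Subcoalgebras as subbimodules\<close>

lemma subcoalgebra_subspace: "subcoalgebra C \<Longrightarrow> subspace C"
  by (simp add: subcoalgebra_def)

lemma sweedler_subcoalgebra:
  assumes "subcoalgebra C" "x \<in> C"
  obtains t where "set t \<subseteq> C \<times> C"
    "\<And>\<beta>. bilinear_form \<beta> \<Longrightarrow> sweedler x \<beta> = (\<Sum>(a, b)\<leftarrow>t. \<beta> a b)"
proof -
  obtain t where t: "set t \<subseteq> C \<times> C" "\<Delta> x \<approx>\<^sub>2 t"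
    using assms unfolding subcoalgebra_def by blast
  show thesis using that[OF t(1)] tensor_eq2_bilinear[OF t(2)] by (simp add: sweedler_def)
qed

lemma sweedler_subcoalgebra_cong:
  assumes "subcoalgebra C" "x \<in> C" "bilinear_form \<beta>" "bilinear_form \<gamma>"
    and "\<And>a b. a \<in> C \<Longrightarrow> b \<in> C \<Longrightarrow> \<beta> a b = \<gamma> a b"
  shows "sweedler x \<beta> = sweedler x \<gamma>"
proof -
  obtain t where t: "set t \<subseteq> C \<times> C"
    "\<And>\<beta>. bilinear_form \<beta> \<Longrightarrow> sweedler x \<beta> = (\<Sum>(a, b)\<leftarrow>t. \<beta> a b)"
    using sweedler_subcoalgebra[OF assms(1,2)] by blast
  have "(\<Sum>(a, b)\<leftarrow>t. \<beta> a b) = (\<Sum>(a, b)\<leftarrow>t. \<gamma> a b)"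
    using t(1) assms(5) by (intro arg_cong[where f = sum_list] map_cong) auto
  then show ?thesis using t(2) assms(3,4) by simp
qed

lemma left_act_subcoalgebra:
  assumes C: "subcoalgebra C" "x \<in> C" and d: "linear_form d"
  shows "d \<rightharpoonup> x \<in> C"
proof -
  obtain t where t: "set t \<subseteq> C \<times> C"
    "\<And>\<beta>. bilinear_form \<beta> \<Longrightarrow> sweedler x \<beta> = (\<Sum>(a, b)\<leftarrow>t. \<beta> a b)"
    using sweedler_subcoalgebra[OF C] by blast
  have "d \<rightharpoonup> x = (\<Sum>(a, b)\<leftarrow>t. d b *s a)"
    by (rule linear_forms_eqI)
      (simp add: form_left_act t(2) bilinear_form_mult d linear_form_sum_list linear_form_scale
        case_prod_unfold mult.commute)
  also have "\<dots> \<in> C"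
    using t(1) subcoalgebra_subspace[OF C(1)]
    by (induction t) (auto simp: subspace_0 intro!: subspace_add subspace_scale)
  finally show ?thesis .
qed

lemma right_act_subcoalgebra:
  assumes C: "subcoalgebra C" "x \<in> C" and d: "linear_form d"
  shows "x \<leftharpoonup> d \<in> C"
proof -
  obtain t where t: "set t \<subseteq> C \<times> C"
    "\<And>\<beta>. bilinear_form \<beta> \<Longrightarrow> sweedler x \<beta> = (\<Sum>(a, b)\<leftarrow>t. \<beta> a b)"
    using sweedler_subcoalgebra[OF C] by blast
  have "x \<leftharpoonup> d = (\<Sum>(a, b)\<leftarrow>t. d a *s b)"
    by (rule linear_forms_eqI)
      (simp add: form_right_act t(2) bilinear_form_mult d linear_form_sum_list linear_form_scale
        case_prod_unfold)
  also have "\<dots> \<in> C"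
    using t(1) subcoalgebra_subspace[OF C(1)]
    by (induction t) (auto simp: subspace_0 intro!: subspace_add subspace_scale)
  finally show ?thesis .
qed

lemma left_act_cong:
  assumes "subcoalgebra C" "x \<in> C" "linear_form c" "linear_form d" "\<And>y. y \<in> C \<Longrightarrow> c y = d y"
  shows "c \<rightharpoonup> x = d \<rightharpoonup> x"
proof (rule linear_forms_eqI)
  fix e assume e: "linear_form e"
  note forms = e assms(3,4)
  have "sweedler x (\<lambda>a b. e a * c b) = sweedler x (\<lambda>a b. e a * d b)"
    by (rule sweedler_subcoalgebra_cong[OF assms(1,2)])
      (rule bilinear_form_mult forms | simp add: assms(5))+
  then show "e (c \<rightharpoonup> x) = e (d \<rightharpoonup> x)"
    by (simp add: form_left_act[OF e])
qed

lemma right_act_cong: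
  assumes "subcoalgebra C" "x \<in> C" "linear_form c" "linear_form d" "\<And>y. y \<in> C \<Longrightarrow> c y = d y"
  shows "x \<leftharpoonup> c = x \<leftharpoonup> d"
proof (rule linear_forms_eqI)
  fix e assume e: "linear_form e"
  note forms = e assms(3,4)
  have "sweedler x (\<lambda>a b. c a * e b) = sweedler x (\<lambda>a b. d a * e b)"
    by (rule sweedler_subcoalgebra_cong[OF assms(1,2)])
      (rule bilinear_form_mult forms | simp add: assms(5))+
  then show "e (x \<leftharpoonup> c) = e (x \<leftharpoonup> d)"
    by (simp add: form_right_act[OF e])
qed

lemma zero_left_act: "(\<lambda>_. 0) \<rightharpoonup> x = 0"
  by (simp add: left_act_def case_prod_unfold)

lemma right_act_zero: "x \<leftharpoonup> (\<lambda>_. 0) = 0"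
  by (simp add: right_act_def case_prod_unfold)

text \<open>Let \<open>P\<close> project linearly onto \<open>D\<close> and put \<open>Q = 1 - P\<close>. For \<open>x \<in> D\<close>, stability under the right
  action makes \<open>\<Sum> c(x\<^sub>1) Q(x\<^sub>2)\<close> vanish, and stability under the left action \<open>\<Sum> c(x\<^sub>2) Q(x\<^sub>1)\<close>, for all
  linear forms \<open>c\<close>. Hence \<open>(1 \<otimes> Q) \<Delta> x = 0\<close> and \<open>(Q \<otimes> P) \<Delta> x = 0\<close>, so that \<open>\<Delta> x = (P \<otimes> P) \<Delta> x\<close>.\<close>

lemma subcoalgebraI_stable:
  assumes D: "subspace D"
    and left: "\<And>x c. x \<in> D \<Longrightarrow> linear_form c \<Longrightarrow> c \<rightharpoonup> x \<in> D"
    and right: "\<And>x c. x \<in> D \<Longrightarrow> linear_form c \<Longrightarrow> x \<leftharpoonup> c \<in> D"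
  shows "subcoalgebra D"
proof -
  obtain P where P: "linear_op P" "\<And>x. P x \<in> D" "\<And>x. x \<in> D \<Longrightarrow> P x = x"
  proof -
    interpret vector_space_pair scale scale
      by (intro vector_space_pair.intro vector_space_axioms)
    show thesis
      using linear_exists_left_inverse_on[OF linear_op_id D] that by auto
  qed
  define Q where "Q x = x - P x" for x
  have Q: "linear_op Q" unfolding Q_def by (intro linear_op_minus linear_op_id P)
  have QD: "Q x = 0" if "x \<in> D" for x using P that by (simp add: Q_def)
  have proj: "sweedler x \<beta> = sweedler x (\<lambda>a b. \<beta> (P a) (P b))" if "x \<in> D" and \<beta>: "bilinear_form \<beta>" for x \<beta>
  proof -
    note l = linear_form_comp[OF bilinear_form_left[OF \<beta>]]
    note r = linear_form_comp[OF bilinear_form_right[OF \<beta>]]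
    have 1: "sweedler x (\<lambda>a b. \<beta> a (Q b)) = 0"
    proof (rule sweedler_eq_0)
      show "bilinear_form (\<lambda>a b. \<beta> a (Q b))"
        by (intro bilinear_formI bilinear_form_left[OF \<beta>] r Q)
      fix c y assume c: "linear_form c"
      have "sweedler x (\<lambda>a b. c a * \<beta> y (Q b)) = \<beta> y (Q (x \<leftharpoonup> c))"
        using form_right_act[OF r[OF Q]] by metis
      also have "\<dots> = 0"
        using QD[OF right[OF that(1) c]] linear_form_zero[OF bilinear_form_right[OF \<beta>]] by simp
      finally show "sweedler x (\<lambda>a b. c a * \<beta> y (Q b)) = 0" .
    qed
    have flip: "sweedler x (\<lambda>a b. \<gamma> a b) = 0"
      if \<gamma>: "bilinear_form \<gamma>" and z: "\<And>c y. linear_form c \<Longrightarrow> sweedler x (\<lambda>a b. c b * \<gamma> a y) = 0" for \<gamma>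
    proof -
      have "(\<Sum>(b, a)\<leftarrow>map prod.swap (\<Delta> x). \<gamma> a b) = 0"
        using z by (intro bilinear_sum_eq_0[OF bilinear_form_flip[OF \<gamma>]])
          (simp add: sweedler_def case_prod_unfold comp_def)
      then show ?thesis by (simp add: sweedler_def case_prod_unfold comp_def)
    qed
    have 2: "sweedler x (\<lambda>a b. \<beta> (Q a) (P b)) = 0"
    proof (rule flip)
      show "bilinear_form (\<lambda>a b. \<beta> (Q a) (P b))"
        by (intro bilinear_formI l r Q P)
      fix c y assume c: "linear_form c"
      have "sweedler x (\<lambda>a b. c b * \<beta> (Q a) (P y)) = \<beta> (Q (c \<rightharpoonup> x)) (P y)"
        by (subst form_left_act[OF l[OF Q]]) (simp add: mult.commute)
      also have "\<dots> = 0"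
        using QD[OF left[OF that(1) c]] linear_form_zero[OF bilinear_form_left[OF \<beta>]] by simp
      finally show "sweedler x (\<lambda>a b. c b * \<beta> (Q a) (P y)) = 0" .
    qed
    have "\<beta> a b = \<beta> a (Q b) + (\<beta> (Q a) (P b) + \<beta> (P a) (P b))" for a b
      using linear_form_diff[OF bilinear_form_left[OF \<beta>]] linear_form_diff[OF bilinear_form_right[OF \<beta>]]
      by (simp add: Q_def)
    then have "sweedler x \<beta> = sweedler x (\<lambda>a b. \<beta> a (Q b) + (\<beta> (Q a) (P b) + \<beta> (P a) (P b)))"
      by metis
    then show ?thesis using 1 2 by (simp add: sweedler_add)
  qed
  have "\<Delta> x \<approx>\<^sub>2 map (\<lambda>(a, b). (P a, P b)) (\<Delta> x)" if "x \<in> D" for x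
    using proj[OF that] by (intro tensor_eq2I) (simp add: sweedler_def case_prod_unfold comp_def)
  moreover have "set (map (\<lambda>(a, b). (P a, P b)) (\<Delta> x)) \<subseteq> D \<times> D" for x
    using P(2) by auto
  ultimately show ?thesis unfolding subcoalgebra_def using D by blast
qed

end

section \<open>Irreducible algebras of operators\<close>

locale irreducible_operators = linear_forms scale
  for scale :: "'k::field \<Rightarrow> 'v::ab_group_add \<Rightarrow> 'v"  (infixr \<open>*s\<close> 75) +
  fixes V :: "'v set" and M :: "('v \<Rightarrow> 'v) set"
  assumes V: "subspace V" "V \<noteq> {0}"
    and M_linear: "T \<in> M \<Longrightarrow> linear_op T"
    and M_closed: "T \<in> M \<Longrightarrow> x \<in> V \<Longrightarrow> T x \<in> V"
    and M_id: "(\<lambda>x. x) \<in> M"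
    and M_add: "T \<in> M \<Longrightarrow> U \<in> M \<Longrightarrow> (\<lambda>x. T x + U x) \<in> M"
    and M_diff: "T \<in> M \<Longrightarrow> U \<in> M \<Longrightarrow> (\<lambda>x. T x - U x) \<in> M"
    and M_comp: "T \<in> M \<Longrightarrow> U \<in> M \<Longrightarrow> (\<lambda>x. T (U x)) \<in> M"
    and transitive: "x \<in> V \<Longrightarrow> x \<noteq> 0 \<Longrightarrow> y \<in> V \<Longrightarrow> \<exists>T\<in>M. T x = y"
    and finite_gen: "\<exists>B. finite B \<and> B \<subseteq> V \<and> V \<subseteq> span B"
begin

text \<open>The endomorphisms of the \<open>M\<close>-module \<open>V\<close>. Only their values on \<open>V\<close> are constrained.\<close>

definition commutant :: "('v \<Rightarrow> 'v) set" where
  "commutant = {z. (\<forall>x\<in>V. z x \<in> V) \<and> (\<forall>x\<in>V. \<forall>y\<in>V. z (x + y) = z x + z y) \<and>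
     (\<forall>T\<in>M. \<forall>x\<in>V. z (T x) = T (z x))}"

lemma commutant_closed: "z \<in> commutant \<Longrightarrow> x \<in> V \<Longrightarrow> z x \<in> V"
  and commutant_add: "z \<in> commutant \<Longrightarrow> x \<in> V \<Longrightarrow> y \<in> V \<Longrightarrow> z (x + y) = z x + z y"
  and commutant_commute: "z \<in> commutant \<Longrightarrow> T \<in> M \<Longrightarrow> x \<in> V \<Longrightarrow> z (T x) = T (z x)"
  by (simp_all add: commutant_def)

lemma commutant_zero: "z \<in> commutant \<Longrightarrow> z 0 = 0"
  using commutant_add[of z 0 0] subspace_0[OF V(1)] by simp

lemma commutant_scale: "(\<lambda>x. r *s x) \<in> commutant"
  using V by (auto simp: commutant_def subspace_scale scale_right_distrib
      linear_op_scale[OF M_linear])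

fun commutant_span :: "'v list \<Rightarrow> 'v set" where
  "commutant_span [] = {0}"
| "commutant_span (b # bs) = {z b + y | z y. z \<in> commutant \<and> y \<in> commutant_span bs}"

lemma commutant_span_subset: "set bs \<subseteq> V \<Longrightarrow> commutant_span bs \<subseteq> V"
  using V by (induction bs) (auto simp: subspace_0 commutant_closed intro!: subspace_add)

lemma annihilator_commutant_span:
  assumes "T \<in> M" "set bs \<subseteq> V" "\<And>b. b \<in> set bs \<Longrightarrow> T b = 0" "x \<in> commutant_span bs"
  shows "T x = 0"
  using assms(2-)
proof (induction bs arbitrary: x)
  case Nil
  then show ?case by (simp add: linear_op_zero M_linear assms(1))
next
  case (Cons b bs)
  then obtain z y where zy: "x = z b + y" "z \<in> commutant" "y \<in> commutant_span bs" by auto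
  have "T (z b) = z (T b)" using commutant_commute[OF zy(2) assms(1), of b] Cons.prems by simp
  also have "\<dots> = 0" using Cons.prems by (simp add: commutant_zero[OF zy(2)])
  finally show ?case using Cons zy
    by (simp add: linear_op_add[OF M_linear[OF assms(1)]])
qed

lemma span_subset_commutant_span: "x \<in> span (set bs) \<Longrightarrow> x \<in> commutant_span bs"
proof (induction bs arbitrary: x)
  case Nil
  then show ?case by simp
next
  case (Cons b bs)
  then obtain r where "x - r *s b \<in> span (set bs)" by (auto simp: span_breakdown_eq)
  then have "x - r *s b \<in> commutant_span bs" by (rule Cons.IH)
  then have "\<exists>z y. x = z b + y \<and> z \<in> commutant \<and> y \<in> commutant_span bs"
    by (intro exI[of _ "\<lambda>x. r *s x"] exI[of _ "x - r *s b"]) (simp add: commutant_scale)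
  then show ?case by simp
qed

text \<open>Jacobson density, in the form of a double annihilator property. In the induction step suppose that
  some operator that kills \<open>bs\<close> does not kill \<open>w\<close>. By transitivity the operators that kill \<open>bs\<close> send \<open>w\<close>
  to every vector, and \<open>T w \<mapsto> T x\<close>, for \<open>T\<close> killing \<open>bs\<close>, is a well-defined element \<open>z\<close> of the
  commutant. Then \<open>T (x - z w) = 0\<close> for all such \<open>T\<close>, and the induction hypothesis applies to
  \<open>x - z w\<close>.\<close>

lemma double_annihilator:
  assumes "set bs \<subseteq> V" "x \<in> V"
    and "\<And>T. T \<in> M \<Longrightarrow> (\<And>b. b \<in> set bs \<Longrightarrow> T b = 0) \<Longrightarrow> T x = 0"
  shows "x \<in> commutant_span bs"
  using assms
proof (induction bs arbitrary: x)
  case Nil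
  then show ?case using M_id by fastforce
next
  case (Cons w bs)
  define ann where "ann = {T \<in> M. \<forall>b\<in>set bs. T b = 0}"
  have w: "w \<in> V" using Cons.prems by simp
  have kill: "T x = 0" if "T \<in> ann" "T w = 0" for T
    using Cons.prems(3)[of T] that by (auto simp: ann_def)
  show ?case
  proof (cases "\<forall>T\<in>ann. T w = 0")
    case True
    then have "x \<in> commutant_span bs"
      using kill Cons.prems by (intro Cons.IH) (auto simp: ann_def)
    then have "\<exists>z y. x = z w + y \<and> z \<in> commutant \<and> y \<in> commutant_span bs"
      using commutant_scale[of 0] by (intro exI[of _ "\<lambda>x. 0 *s x"] exI[of _ x]) simp
    then show ?thesis by simp
  next
    case False
    then obtain T0 where T0: "T0 \<in> ann" "T0 w \<noteq> 0" by blast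
    have ann_comp: "(\<lambda>x. U (T x)) \<in> ann" if "U \<in> M" "T \<in> ann" for U T
      using that by (auto simp: ann_def M_comp linear_op_zero M_linear)
    have ann_ex: "\<exists>T\<in>ann. T w = y" if "y \<in> V" for y
    proof -
      have "T0 w \<in> V" using T0(1) w by (simp add: ann_def M_closed)
      from transitive[OF this T0(2) that] obtain U where "U \<in> M" "U (T0 w) = y" by blast
      then show ?thesis using ann_comp[OF _ T0(1), of U] by (intro bexI) auto
    qed
    have welldef: "T x = T' x" if "T \<in> ann" "T' \<in> ann" "T w = T' w" for T T'
    proof -
      have "(\<lambda>x. T x - T' x) \<in> ann" using that by (auto simp: ann_def M_diff)
      from kill[OF this] that(3) show ?thesis by simp
    qed
    define z where "z y = (SOME T. T \<in> ann \<and> T w = y) x" for y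
    have z: "z (T w) = T x" if "T \<in> ann" for T
    proof -
      have "(SOME U. U \<in> ann \<and> U w = T w) \<in> ann \<and> (SOME U. U \<in> ann \<and> U w = T w) w = T w"
        using someI[of "\<lambda>U. U \<in> ann \<and> U w = T w", OF conjI[OF that refl]] .
      then show ?thesis unfolding z_def using welldef[OF _ that] by simp
    qed
    have "z \<in> commutant"
      unfolding commutant_def
    proof (intro CollectI conjI ballI)
      fix y assume y: "y \<in> V"
      obtain T where T: "T \<in> ann" "T w = y" using ann_ex[OF y] by blast
      show "z y \<in> V" using z[OF T(1)] T Cons.prems(2) by (simp add: ann_def M_closed)
      show "z (y + y') = z y + z y'" if y': "y' \<in> V" for y'
      proof -
        obtain T' where T': "T' \<in> ann" "T' w = y'" using ann_ex[OF y'] by blast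
        have "(\<lambda>x. T x + T' x) \<in> ann" using T T' by (auto simp: ann_def M_add)
        from z[OF this] z[OF T(1)] z[OF T'(1)] show ?thesis using T T' by simp
      qed
      show "z (U y) = U (z y)" if U: "U \<in> M" for U
        using z[OF ann_comp[OF U T(1)]] z[OF T(1)] T by simp
    qed
    moreover have "x - z w \<in> commutant_span bs"
    proof (rule Cons.IH)
      show "set bs \<subseteq> V" using Cons.prems by simp
      show "x - z w \<in> V" using commutant_closed[OF \<open>z \<in> commutant\<close> w] V Cons.prems(2)
        by (simp add: subspace_diff)
      fix T assume "T \<in> M" "\<And>b. b \<in> set bs \<Longrightarrow> T b = 0"
      then have T: "T \<in> ann" by (simp add: ann_def)
      show "T (x - z w) = 0"
        using z[OF T] commutant_commute[OF \<open>z \<in> commutant\<close> \<open>T \<in> M\<close> w]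
        by (simp add: linear_op_diff[OF M_linear[OF \<open>T \<in> M\<close>]])
    qed
    ultimately have "\<exists>z y. x = z w + y \<and> z \<in> commutant \<and> y \<in> commutant_span bs"
      by (intro exI[of _ z] exI[of _ "x - z w"]) simp
    then show ?thesis by simp
  qed
qed

text \<open>In a generating list of minimal length the remaining vectors do not generate \<open>V\<close>, so by density
  some operator kills them but not \<open>V\<close>. It cannot kill the head \<open>w\<close>, and after composition with a
  suitable operator it fixes \<open>w\<close>.\<close>

lemma projection_exists:
  obtains bs p w where "set bs \<subseteq> V" "commutant_span bs = V"
    "p \<in> M" "w \<in> V" "w \<noteq> 0" "p w = w" "\<And>x. x \<in> V \<Longrightarrow> \<exists>z\<in>commutant. p x = z w"
proof -
  have "\<exists>bs. set bs \<subseteq> V \<and> commutant_span bs = V"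
  proof -
    obtain B where B: "finite B" "B \<subseteq> V" "V \<subseteq> span B" using finite_gen by blast
    obtain bs where bs: "set bs = B" using finite_list[OF B(1)] by auto
    have "set bs \<subseteq> V" "V \<subseteq> commutant_span bs"
      using B(2,3) span_subset_commutant_span[of _ bs] unfolding bs by blast+
    then show ?thesis using commutant_span_subset[of bs] by blast
  qed
  then obtain cs where "set cs \<subseteq> V \<and> commutant_span cs = V" by blast
  from ex_has_least_nat[of "\<lambda>bs. set bs \<subseteq> V \<and> commutant_span bs = V", OF this, of length]
  obtain bs where least_bs: "(set bs \<subseteq> V \<and> commutant_span bs = V) \<and>
      (\<forall>cs. set cs \<subseteq> V \<and> commutant_span cs = V \<longrightarrow> length bs \<le> length cs)"
    by (rule exE)
  then have bs: "set bs \<subseteq> V" "commutant_span bs = V" by simp_all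
  have least: "length bs \<le> length cs" if "set cs \<subseteq> V" "commutant_span cs = V" for cs
    using conjunct2[OF least_bs] that by simp
  have "bs \<noteq> []"
  proof
    assume "bs = []"
    then have "V = {0}" using bs(2) by simp
    then show False using V(2) by simp
  qed
  then obtain w rest where wr: "bs = w # rest" by (cases bs) auto
  have rest: "set rest \<subseteq> V" using bs wr by simp
  then have "commutant_span rest \<noteq> V" using least[of rest] wr by auto
  then obtain u where u: "u \<in> V" "u \<notin> commutant_span rest"
    using commutant_span_subset[OF rest] by blast
  then obtain T where T: "T \<in> M" "\<And>b. b \<in> set rest \<Longrightarrow> T b = 0" "T u \<noteq> 0"
    using double_annihilator[OF rest] by metis
  have Tw: "T w \<noteq> 0"
  proof
    assume "T w = 0"
    then have "T b = 0" if "b \<in> set bs" for b using that T(2) wr by auto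
    from annihilator_commutant_span[OF T(1) bs(1) this] bs(2) u(1) T(3) show False by blast
  qed
  have w: "w \<in> V" using bs wr by simp
  obtain U where U: "U \<in> M" "U (T w) = w"
    using transitive[OF M_closed[OF T(1) w] Tw w] by blast
  define p where "p x = U (T x)" for x
  have p: "p \<in> M" "p w = w"
    unfolding p_def using M_comp U T by auto
  have p0: "p b = 0" if "b \<in> set rest" for b
    using T(2)[OF that] linear_op_zero[OF M_linear[OF U(1)]] by (simp add: p_def)
  have "\<exists>z\<in>commutant. p x = z w" if x: "x \<in> V" for x
  proof -
    obtain z y where zy: "x = z w + y" "z \<in> commutant" "y \<in> commutant_span rest"
    proof -
      have "x \<in> commutant_span (w # rest)" using x bs(2) unfolding wr by simp
      then show thesis using that by auto
    qed
    have "p y = 0" by (rule annihilator_commutant_span[OF p(1) rest p0 zy(3)])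
    then have "p x = z w"
      using zy p commutant_commute[OF zy(2) p(1) w]
      by (simp add: linear_op_add[OF M_linear[OF p(1)]])
    then show ?thesis using zy by blast
  qed
  moreover have "w \<noteq> 0" using Tw linear_op_zero[OF M_linear[OF T(1)]] by auto
  ultimately show thesis using that bs p w by blast
qed

lemma M_sum_list: "(\<And>T. T \<in> set Ts \<Longrightarrow> f T \<in> M) \<Longrightarrow> (\<lambda>x. \<Sum>T\<leftarrow>Ts. f T x) \<in> M"
proof (induction Ts)
  case Nil
  show ?case using M_diff[OF M_id M_id] by simp
next
  case (Cons T Ts)
  have "f T \<in> M" "(\<lambda>x. \<Sum>T\<leftarrow>Ts. f T x) \<in> M" using Cons by auto
  from M_add[OF this] show ?case by simp
qed

text \<open>The two-sided ideal generated by \<open>p\<close> contains the identity of \<open>V\<close>. An element of the ideal that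
  fixes a list of vectors is corrected at one further vector \<open>u\<close>, without disturbing the others, by
  adding \<open>m p T\<close> where \<open>T\<close> kills the list, \<open>T u = w\<close>, and \<open>m\<close> sends \<open>w\<close> to the error at \<open>u\<close>.
  If no operator killing the list moves \<open>u\<close>, there is no error.\<close>

lemma identity_from_projection:
  assumes bs: "set bs \<subseteq> V" "commutant_span bs = V"
    and p: "p \<in> M" "w \<in> V" "w \<noteq> 0" "p w = w"
  obtains ps where "\<And>m n. (m, n) \<in> set ps \<Longrightarrow> m \<in> M \<and> n \<in> M"
    "\<And>x. x \<in> V \<Longrightarrow> (\<Sum>(m, n)\<leftarrow>ps. m (p (n x))) = x"
proof -
  let ?op = "\<lambda>ps x. \<Sum>(m, n)\<leftarrow>ps. m (p (n x))"
  have in_M: "?op ps \<in> M" if "set ps \<subseteq> M \<times> M" for ps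
  proof -
    have "(\<lambda>x. fst mn (p (snd mn x))) \<in> M" if "mn \<in> set ps" for mn
      using M_comp[OF _ M_comp[OF p(1)]] that \<open>set ps \<subseteq> M \<times> M\<close> by auto
    from M_sum_list[of ps "\<lambda>mn x. fst mn (p (snd mn x))", OF this] show ?thesis
      by (simp add: case_prod_unfold)
  qed
  have fix_all: "\<forall>x\<in>commutant_span cs. ?op ps x = x"
    if "set ps \<subseteq> M \<times> M" "set cs \<subseteq> V" "\<forall>x\<in>set cs. ?op ps x = x" for ps cs
  proof
    fix x assume "x \<in> commutant_span cs"
    from annihilator_commutant_span[OF M_diff[OF in_M[OF that(1)] M_id] that(2) _ this] that(3)
    show "?op ps x = x" by simp
  qed
  have "\<exists>ps. set ps \<subseteq> M \<times> M \<and> (\<forall>x\<in>set cs. ?op ps x = x)" if "set cs \<subseteq> V" for cs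
    using that
  proof (induction cs)
    case Nil
    show ?case by (intro exI[of _ "[]"]) simp
  next
    case (Cons u cs)
    then obtain ps where ps: "set ps \<subseteq> M \<times> M" "\<forall>x\<in>set cs. ?op ps x = x" by auto
    show ?case
    proof (cases "u \<in> commutant_span cs")
      case True
      have "set cs \<subseteq> V" using Cons.prems by simp
      from fix_all[OF ps(1) this ps(2)] True have "?op ps u = u" by blast
      then have "\<forall>x\<in>set (u # cs). ?op ps x = x" using ps(2) by (metis set_ConsD)
      then show ?thesis using ps(1) by blast
    next
      case False
      then obtain T where T: "T \<in> M" "\<And>b. b \<in> set cs \<Longrightarrow> T b = 0" "T u \<noteq> 0"
        using double_annihilator[of cs u] Cons.prems by (metis insert_subset list.simps(15))
      have u: "u \<in> V" using Cons.prems by simp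
      obtain U where U: "U \<in> M" "U (T u) = w"
        using transitive[OF M_closed[OF T(1) u] T(3) p(2)] by blast
      have "u - ?op ps u \<in> V" using M_closed[OF in_M[OF ps(1)] u] u V by (simp add: subspace_diff)
      then obtain m where m: "m \<in> M" "m w = u - ?op ps u" using transitive[OF p(2,3)] by blast
      have "?op ((m, \<lambda>x. U (T x)) # ps) x = x" if "x \<in> set (u # cs)" for x
      proof (cases "x = u")
        case True
        then show ?thesis using U(2) m(2) p(4) by simp
      next
        case False
        then have x: "x \<in> set cs" using that by simp
        then have "m (p (U (T x))) = 0"
          using linear_op_zero M_linear T(2) U(1) m(1) p(1) by metis
        then show ?thesis using x ps(2) by simp
      qed
      moreover have "set ((m, \<lambda>x. U (T x)) # ps) \<subseteq> M \<times> M"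
        using m U T ps M_comp by auto
      ultimately show ?thesis by blast
    qed
  qed
  from this[OF bs(1)] obtain ps where ps: "set ps \<subseteq> M \<times> M" "\<forall>x\<in>set bs. ?op ps x = x" by blast
  show thesis
  proof (rule that)
    show "?op ps x = x" if "x \<in> V" for x
      using fix_all[OF ps(1) bs(1) ps(2)] bs(2) that by blast
    show "m \<in> M \<and> n \<in> M" if "(m, n) \<in> set ps" for m n using that ps(1) by blast
  qed
qed

text \<open>A nonzero trace on \<open>M\<close> of the form \<open>T \<mapsto> \<Sum> g(T v)\<close>. Write the identity as \<open>\<Sum> m\<^sub>i p n\<^sub>i\<close> with \<open>p\<close>
  projecting onto the line of \<open>w\<close> over the commutant. The corner \<open>p M p\<close> is commutative since the
  commutant is, and \<open>T \<mapsto> \<Sum> p n\<^sub>i T m\<^sub>i p\<close> is the Hattori--Stallings trace with values in the corner;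
  here it is applied to \<open>w\<close> and followed by a linear form \<open>\<psi>\<close> with \<open>\<psi> w = 1\<close>. For the trace property
  the identity is inserted between \<open>T\<close> and \<open>U\<close>, and the two resulting factors commute in the corner.\<close>

lemma trace_exists:
  assumes comm: "\<And>z z' x. z \<in> commutant \<Longrightarrow> z' \<in> commutant \<Longrightarrow> x \<in> V \<Longrightarrow> z (z' x) = z' (z x)"
  obtains gvs T\<^sub>0 where "\<And>g v. (g, v) \<in> set gvs \<Longrightarrow> linear_form g \<and> v \<in> V"
    "\<And>T U. T \<in> M \<Longrightarrow> U \<in> M \<Longrightarrow> (\<Sum>(g, v)\<leftarrow>gvs. g (T (U v))) = (\<Sum>(g, v)\<leftarrow>gvs. g (U (T v)))"
    "T\<^sub>0 \<in> M" "(\<Sum>(g, v)\<leftarrow>gvs. g (T\<^sub>0 v)) \<noteq> 0"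
proof -
  obtain bs p w where bs: "set bs \<subseteq> V" "commutant_span bs = V"
    and p: "p \<in> M" "w \<in> V" "w \<noteq> 0" "p w = w" and proj: "\<And>x. x \<in> V \<Longrightarrow> \<exists>z\<in>commutant. p x = z w"
    using projection_exists by blast
  obtain ps where ps: "\<And>m n. (m, n) \<in> set ps \<Longrightarrow> m \<in> M \<and> n \<in> M"
    and unit: "\<And>x. x \<in> V \<Longrightarrow> (\<Sum>(m, n)\<leftarrow>ps. m (p (n x))) = x"
    using identity_from_projection[OF bs p] by blast
  obtain \<psi> where \<psi>: "linear_form \<psi>" "\<psi> w = 1"
    using linear_form_separating[OF subspace_single_0, of w] p(3) by auto
  note pl = M_linear[OF p(1)]
  have corner: "p (a (p (b w))) = p (b (p (a w)))" if ab: "a \<in> M" "b \<in> M" for a b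
  proof -
    obtain z z' where z: "z \<in> commutant" "p (a w) = z w" and z': "z' \<in> commutant" "p (b w) = z' w"
      using proj[OF M_closed[OF ab(1) p(2)]] proj[OF M_closed[OF ab(2) p(2)]] by auto
    have "p (a (z' w)) = z' (z w)"
      using commutant_commute[OF z'(1) M_comp[OF p(1) ab(1)] p(2)] z(2) by simp
    moreover have "p (b (z w)) = z (z' w)"
      using commutant_commute[OF z(1) M_comp[OF p(1) ab(2)] p(2)] z'(2) by simp
    ultimately show ?thesis using comm[OF z(1) z'(1) p(2)] z(2) z'(2) by simp
  qed
  define gvs where "gvs = map (\<lambda>(m, n). (\<lambda>x. \<psi> (p (n x)), m w)) ps"
  have eval: "(\<Sum>(g, v)\<leftarrow>gvs. g (T v)) = (\<Sum>(m, n)\<leftarrow>ps. \<psi> (p (n (T (m w)))))" for T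
    unfolding gvs_def by (simp add: case_prod_unfold comp_def)
  have expand: "(\<Sum>(m, n)\<leftarrow>ps. \<psi> (p (n (T (U (m w)))))) =
      (\<Sum>(m, n)\<leftarrow>ps. \<Sum>(m', n')\<leftarrow>ps. \<psi> (p (n (T (m' (p (n' (U (m w)))))))))"
    if "T \<in> M" "U \<in> M" for T U
  proof -
    have "\<psi> (p (n (T (U (m w))))) = (\<Sum>(m', n')\<leftarrow>ps. \<psi> (p (n (T (m' (p (n' (U (m w)))))))))"
      if mn: "(m, n) \<in> set ps" for m n
    proof -
      have f: "linear_form (\<lambda>x. \<psi> (p (n (T x))))"
        using linear_form_comp[OF \<psi>(1) M_linear[OF M_comp[OF p(1) M_comp[OF _ \<open>T \<in> M\<close>]]]] ps[OF mn]
        by blast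
      have "U (m w) \<in> V" using ps[OF mn] M_closed[OF \<open>U \<in> M\<close> M_closed[OF _ p(2)]] by simp
      from unit[OF this] have "U (m w) = (\<Sum>(m', n')\<leftarrow>ps. m' (p (n' (U (m w)))))" by (rule sym)
      then have "\<psi> (p (n (T (U (m w))))) = \<psi> (p (n (T (\<Sum>(m', n')\<leftarrow>ps. m' (p (n' (U (m w))))))))"
        by (rule arg_cong[where f = "\<lambda>x. \<psi> (p (n (T x)))"])
      also have "\<dots> = (\<Sum>(m', n')\<leftarrow>ps. \<psi> (p (n (T (m' (p (n' (U (m w)))))))))"
        using linear_form_sum_list[OF f, of "\<lambda>mn. fst mn (p (snd mn (U (m w))))" ps]
        by (simp add: case_prod_unfold)
      finally show ?thesis .
    qed
    then show ?thesis by (intro arg_cong[where f = sum_list] map_cong) auto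
  qed
  have trace: "(\<Sum>(m, n)\<leftarrow>ps. \<psi> (p (n (T (U (m w)))))) = (\<Sum>(m, n)\<leftarrow>ps. \<psi> (p (n (U (T (m w))))))"
    if T: "T \<in> M" and U: "U \<in> M" for T U
  proof -
    have "\<psi> (p (n (T (m' (p (n' (U (m w)))))))) = \<psi> (p (n' (U (m (p (n (T (m' w))))))))"
      if "(m, n) \<in> set ps" "(m', n') \<in> set ps" for m n m' n'
    proof -
      have "(\<lambda>x. n (T (m' x))) \<in> M" "(\<lambda>x. n' (U (m x))) \<in> M"
        using ps[OF that(1)] ps[OF that(2)] M_comp[OF _ M_comp[OF T]] M_comp[OF _ M_comp[OF U]]
        by simp_all
      from corner[OF this] show ?thesis by simp
    qed
    then have "(\<Sum>(m, n)\<leftarrow>ps. \<Sum>(m', n')\<leftarrow>ps. \<psi> (p (n (T (m' (p (n' (U (m w))))))))) =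
        (\<Sum>(m, n)\<leftarrow>ps. \<Sum>(m', n')\<leftarrow>ps. \<psi> (p (n' (U (m (p (n (T (m' w)))))))))"
      by (intro arg_cong[where f = sum_list] map_cong) (auto intro!: arg_cong[where f = sum_list] map_cong)
    also have "\<dots> = (\<Sum>(m', n')\<leftarrow>ps. \<Sum>(m, n)\<leftarrow>ps. \<psi> (p (n' (U (m (p (n (T (m' w)))))))))"
      unfolding case_prod_unfold by (rule sum_list_swap)
    finally show ?thesis using expand[OF T U] expand[OF U T] by simp
  qed
  \<comment> \<open>At \<open>w\<close> the trace of \<open>p\<close> has the value \<open>\<Sum> p n p m w = \<Sum> p m p n w = p w = w\<close>.\<close>
  have "(\<Sum>(m, n)\<leftarrow>ps. \<psi> (p (n (p (m w))))) = 1"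
  proof -
    have f: "linear_form (\<lambda>x. \<psi> (p x))" by (intro linear_form_comp[OF \<psi>(1)] pl)
    have "(\<Sum>(m, n)\<leftarrow>ps. \<psi> (p (n (p (m w))))) = (\<Sum>(m, n)\<leftarrow>ps. \<psi> (p (m (p (n w)))))"
      using corner ps by (intro arg_cong[where f = sum_list] map_cong) auto
    also have "\<dots> = \<psi> (p (\<Sum>(m, n)\<leftarrow>ps. m (p (n w))))"
      using linear_form_sum_list[OF f, of "\<lambda>mn. fst mn (p (snd mn w))" ps]
      by (simp add: case_prod_unfold)
    also have "\<dots> = 1" using unit[OF p(2)] p(4) \<psi>(2) by simp
    finally show ?thesis .
  qed
  moreover have "linear_form g \<and> v \<in> V" if gv: "(g, v) \<in> set gvs" for g v
  proof -
    obtain m n where mn: "(m, n) \<in> set ps" "g = (\<lambda>x. \<psi> (p (n x)))" "v = m w"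
      using gv unfolding gvs_def by auto
    then show ?thesis
      using ps[OF mn(1)] linear_form_comp[OF \<psi>(1) M_linear[OF M_comp[OF p(1)]], of n] M_closed[OF _ p(2)]
      by simp
  qed
  ultimately show thesis
    using that[of gvs p] trace p(1) by (simp add: eval)
qed

end

section \<open>Identities in Hopf algebras\<close>

context hopf_algebra
begin

lemma linear_op_mult_left: "linear_op g \<Longrightarrow> linear_op (\<lambda>x. y * g x)"
  and linear_op_mult_right: "linear_op g \<Longrightarrow> linear_op (\<lambda>x. g x * y)"
  by (simp_all add: linear_op_iff algebra_simps scale_mult_left scale_mult_right)

lemma linear_op_antipode: "linear_op g \<Longrightarrow> linear_op (\<lambda>x. S (g x))"
  using antipode_linear by (simp add: linear_op_iff)

lemmas multilinear_intros =
  linear_op_id linear_op_mult_left linear_op_mult_right linear_op_antipode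
  bilinear_formI trilinear_formI linear_form_cmult linear_form_multc
  linear_form_sweedler_inner linear_form_sweedler_comp

lemma sweedler_mult:
  assumes "bilinear_form \<beta>"
  shows "sweedler (x * y) \<beta> = sweedler x (\<lambda>a b. sweedler y (\<lambda>p q. \<beta> (a * p) (b * q)))"
  using tensor_eq2_bilinear[OF comult_mult assms, of x y]
  by (simp add: sweedler_def sum_list_concat_map case_prod_unfold map_concat comp_def)

lemma sweedler_one: "bilinear_form \<beta> \<Longrightarrow> sweedler 1 \<beta> = \<beta> 1 1"
  using tensor_eq2_bilinear[OF comult_one] by (simp add: sweedler_def)

lemma sweedler_antipode_left:
  assumes "linear_form c"
  shows "sweedler x (\<lambda>a b. c (S a * b)) = \<epsilon> x * c 1"
proof -
  have "sweedler x (\<lambda>a b. c (S a * b)) = c (\<Sum>(a, b)\<leftarrow>\<Delta> x. S a * b)"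
    by (simp add: sweedler_def case_prod_unfold linear_form_sum_list[OF assms])
  then show ?thesis by (simp add: antipode_left linear_form_scale[OF assms])
qed

lemma sweedler_antipode_right:
  assumes "linear_form c"
  shows "sweedler x (\<lambda>a b. c (a * S b)) = \<epsilon> x * c 1"
proof -
  have "sweedler x (\<lambda>a b. c (a * S b)) = c (\<Sum>(a, b)\<leftarrow>\<Delta> x. a * S b)"
    by (simp add: sweedler_def case_prod_unfold linear_form_sum_list[OF assms])
  then show ?thesis by (simp add: antipode_right linear_form_scale[OF assms])
qed

lemma left_act_one: "linear_form c \<Longrightarrow> c \<rightharpoonup> 1 = c 1 *s 1"
  by (rule linear_forms_eqI)
    (simp add: form_left_act sweedler_one bilinear_form_mult linear_form_scale mult.commute)

lemma right_act_one: "linear_form c \<Longrightarrow> 1 \<leftharpoonup> c = c 1 *s 1"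
  by (rule linear_forms_eqI)
    (simp add: form_right_act sweedler_one bilinear_form_mult linear_form_scale)

lemma antipode_one [simp]: "S 1 = 1"
proof (rule linear_forms_eqI)
  fix c assume c: "linear_form c"
  note c' = linear_form_comp[OF c]
  have "sweedler 1 (\<lambda>a b. c (S a * b)) = c (S 1 * 1)"
    by (rule sweedler_one) (intro multilinear_intros c')
  then show "c (S 1) = c 1" by (simp add: sweedler_antipode_left c counit_one)
qed

text \<open>Both sides are values of \<open>S(x\<^sub>1 y\<^sub>1) x\<^sub>2 y\<^sub>2 S(y\<^sub>3) S(x\<^sub>3)\<close>: the last four factors collapse to
  counits, and so do the first three.\<close>

lemma antipode_mult: "S (x * y) = S y * S x"
proof (rule linear_forms_eqI)
  fix c assume c: "linear_form c"
  note c' = linear_form_comp[OF c]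
  define F where "F a d p r s q = c (S (a * d) * p * r * S s * S q)" for a d p r s q
  \<comment> \<open>Collapse \<open>r S(s)\<close> and then \<open>p S(q)\<close>.\<close>
  have "sweedler x (\<lambda>a b. sweedler y (\<lambda>d e. sweedler b (\<lambda>p q. sweedler e (\<lambda>r s. F a d p r s q)))) =
      c (S (x * y))"
  proof -
    have 1: "sweedler e (\<lambda>r s. F a d p r s q) = \<epsilon> e * c (S (a * d) * p * S q)" for a d e p q
    proof -
      have "linear_form (\<lambda>z. c (S (a * d) * p * z * S q))" by (intro multilinear_intros c')
      from sweedler_antipode_right[OF this, of e] show ?thesis by (simp add: F_def mult.assoc)
    qed
    have 2: "sweedler b (\<lambda>p q. c (S (a * d) * p * S q)) = \<epsilon> b * c (S (a * d))" for a b d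
    proof -
      have "linear_form (\<lambda>z. c (S (a * d) * z))" by (intro multilinear_intros c')
      from sweedler_antipode_right[OF this, of b] show ?thesis by (simp add: mult.assoc)
    qed
    have 3: "sweedler y (\<lambda>d e. c (S (a * d)) * \<epsilon> e) = c (S (a * y))" for a
      by (rule sweedler_counit_right) (intro multilinear_intros c')
    have 4: "sweedler x (\<lambda>a b. c (S (a * y)) * \<epsilon> b) = c (S (x * y))"
      by (rule sweedler_counit_right) (intro multilinear_intros c')
    have "sweedler y (\<lambda>d e. \<epsilon> e * (\<epsilon> b * c (S (a * d)))) = \<epsilon> b * c (S (a * y))" for a b
      using 3[of a] sweedler_const_mult[of y "\<epsilon> b" "\<lambda>d e. c (S (a * d)) * \<epsilon> e"]
      by (simp add: mult.commute mult.left_commute)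
    with 4 show ?thesis
      by (simp add: 1 sweedler_const_mult 2) (simp add: mult.commute)
  qed
  \<comment> \<open>Regroup both arguments by coassociativity and collapse \<open>S(a d) p r\<close> by the antipode relation
    for \<open>u v\<close>, where \<open>\<Delta> u = a \<otimes> p\<close> and \<open>\<Delta> v = d \<otimes> r\<close>.\<close>
  moreover have "sweedler x (\<lambda>a b. sweedler y (\<lambda>d e. sweedler b (\<lambda>p q. sweedler e (\<lambda>r s. F a d p r s q)))) =
      c (S y * S x)"
  proof -
    have "sweedler x (\<lambda>a b. sweedler y (\<lambda>d e. sweedler b (\<lambda>p q. sweedler e (\<lambda>r s. F a d p r s q)))) =
        sweedler x (\<lambda>a b. sweedler b (\<lambda>p q. sweedler y (\<lambda>d e. sweedler e (\<lambda>r s. F a d p r s q))))"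
      by (subst sweedler_swap) (rule refl)
    also have "\<dots> = sweedler x (\<lambda>u q. sweedler u (\<lambda>a p. sweedler y (\<lambda>d e. sweedler e (\<lambda>r s. F a d p r s q))))"
      unfolding F_def by (rule sweedler_coassoc[symmetric]) (intro multilinear_intros c')
    also have "\<dots> = sweedler x (\<lambda>u q. sweedler u (\<lambda>a p. sweedler y (\<lambda>v s. sweedler v (\<lambda>d r. F a d p r s q))))"
    proof -
      have "sweedler y (\<lambda>d e. sweedler e (\<lambda>r s. F a d p r s q)) =
          sweedler y (\<lambda>v s. sweedler v (\<lambda>d r. F a d p r s q))" for a p q
        unfolding F_def by (rule sweedler_coassoc[symmetric]) (intro multilinear_intros c')
      then show ?thesis by simp
    qed
    also have "\<dots> = sweedler x (\<lambda>u q. sweedler y (\<lambda>v s. sweedler u (\<lambda>a p. sweedler v (\<lambda>d r. F a d p r s q))))"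
      by (subst (2) sweedler_swap) (rule refl)
    also have "\<dots> = sweedler x (\<lambda>u q. sweedler y (\<lambda>v s. sweedler (u * v) (\<lambda>m n. c (S m * n * S s * S q))))"
    proof -
      have "sweedler (u * v) (\<lambda>m n. c (S m * n * S s * S q)) =
          sweedler u (\<lambda>a p. sweedler v (\<lambda>d r. F a d p r s q))" for u v s q
        unfolding F_def
        by (subst sweedler_mult) ((intro multilinear_intros c')?, simp add: mult.assoc)
      then show ?thesis by simp
    qed
    also have "\<dots> = sweedler x (\<lambda>u q. sweedler y (\<lambda>v s. \<epsilon> u * (\<epsilon> v * c (S s * S q))))"
    proof -
      have "sweedler z (\<lambda>m n. c (S m * n * S s * S q)) = \<epsilon> z * c (S s * S q)" for z s q
      proof -
        have "linear_form (\<lambda>z. c (z * S s * S q))" by (intro multilinear_intros c')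
        from sweedler_antipode_left[OF this, of z] show ?thesis by simp
      qed
      then show ?thesis by (simp add: counit_mult mult.assoc)
    qed
    also have "\<dots> = sweedler x (\<lambda>u q. \<epsilon> u * c (S y * S q))"
    proof -
      have "sweedler y (\<lambda>v s. \<epsilon> v * c (S s * S q)) = c (S y * S q)" for q
        by (rule sweedler_counit_left) (intro multilinear_intros c')
      then show ?thesis by (simp add: sweedler_const_mult)
    qed
    also have "\<dots> = c (S y * S x)"
      by (rule sweedler_counit_left) (intro multilinear_intros c')
    finally show ?thesis .
  qed
  ultimately show "c (S (x * y)) = c (S y * S x)" by simp
qed

text \<open>The antipode reverses the comultiplication. Consider the tensor
  \<open>S(x\<^sub>1)\<^sub>1 x\<^sub>2 S(x\<^sub>5) \<otimes> S(x\<^sub>1)\<^sub>2 x\<^sub>3 S(x\<^sub>4)\<close>. Collapsing \<open>x\<^sub>3 S(x\<^sub>4)\<close> and then \<open>x\<^sub>2 S(x\<^sub>5)\<close> leaves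
  \<open>\<Delta> (S x)\<close>; reading \<open>S(x\<^sub>1)\<^sub>1 x\<^sub>2 \<otimes> S(x\<^sub>1)\<^sub>2 x\<^sub>3\<close> as \<open>\<Delta> (S(x\<^sub>1) x\<^sub>2)\<close> and collapsing it leaves
  \<open>S(x\<^sub>2) \<otimes> S(x\<^sub>1)\<close>.\<close>

lemma sweedler_antipode:
  assumes \<beta>: "bilinear_form \<beta>"
  shows "sweedler (S x) \<beta> = sweedler x (\<lambda>a b. \<beta> (S b) (S a))"
proof -
  note \<beta>' = linear_form_comp[OF bilinear_form_left[OF \<beta>]] linear_form_comp[OF bilinear_form_right[OF \<beta>]]
  define F where "F p q c\<^sub>1 c\<^sub>2 d\<^sub>1 d\<^sub>2 = \<beta> (p * c\<^sub>1 * S d\<^sub>2) (q * c\<^sub>2 * S d\<^sub>1)" for p q c\<^sub>1 c\<^sub>2 d\<^sub>1 d\<^sub>2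
  \<comment> \<open>In Sweedler notation \<open>T p q b\<close> is \<open>\<beta>(p b\<^sub>1 S(b\<^sub>4), q b\<^sub>2 S(b\<^sub>3))\<close>.\<close>
  define T where "T p q b = sweedler b (\<lambda>b\<^sub>1 b\<^sub>2. sweedler b\<^sub>1 (\<lambda>c\<^sub>1 c\<^sub>2. sweedler b\<^sub>2 (\<lambda>d\<^sub>1 d\<^sub>2. F p q c\<^sub>1 c\<^sub>2 d\<^sub>1 d\<^sub>2)))"
    for p q b
  have T: "T p q b = \<epsilon> b * \<beta> p q" for p q b
  proof -
    have "T p q b = sweedler b (\<lambda>c\<^sub>1 r. sweedler r (\<lambda>c\<^sub>2 b\<^sub>2. sweedler b\<^sub>2 (\<lambda>d\<^sub>1 d\<^sub>2. F p q c\<^sub>1 c\<^sub>2 d\<^sub>1 d\<^sub>2)))"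
      unfolding T_def F_def by (rule sweedler_coassoc) (intro multilinear_intros \<beta>')
    also have "\<dots> = sweedler b (\<lambda>c\<^sub>1 r. sweedler r (\<lambda>m d\<^sub>2. sweedler m (\<lambda>c\<^sub>2 d\<^sub>1. F p q c\<^sub>1 c\<^sub>2 d\<^sub>1 d\<^sub>2)))"
    proof -
      have "sweedler r (\<lambda>c\<^sub>2 b\<^sub>2. sweedler b\<^sub>2 (\<lambda>d\<^sub>1 d\<^sub>2. F p q c\<^sub>1 c\<^sub>2 d\<^sub>1 d\<^sub>2)) =
          sweedler r (\<lambda>m d\<^sub>2. sweedler m (\<lambda>c\<^sub>2 d\<^sub>1. F p q c\<^sub>1 c\<^sub>2 d\<^sub>1 d\<^sub>2))" for r c\<^sub>1
        unfolding F_def by (rule sweedler_coassoc[symmetric]) (intro multilinear_intros \<beta>')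
      then show ?thesis by simp
    qed
    also have "\<dots> = sweedler b (\<lambda>c\<^sub>1 r. sweedler r (\<lambda>m d\<^sub>2. \<epsilon> m * \<beta> (p * c\<^sub>1 * S d\<^sub>2) q))"
    proof -
      have "sweedler m (\<lambda>c\<^sub>2 d\<^sub>1. F p q c\<^sub>1 c\<^sub>2 d\<^sub>1 d\<^sub>2) = \<epsilon> m * \<beta> (p * c\<^sub>1 * S d\<^sub>2) q" for m c\<^sub>1 d\<^sub>2
      proof -
        have "linear_form (\<lambda>z. \<beta> (p * c\<^sub>1 * S d\<^sub>2) (q * z))" by (intro multilinear_intros \<beta>')
        from sweedler_antipode_right[OF this, of m] show ?thesis by (simp add: F_def mult.assoc)
      qed
      then show ?thesis by simp
    qed
    also have "\<dots> = sweedler b (\<lambda>c\<^sub>1 r. \<beta> (p * (c\<^sub>1 * S r)) q)"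
    proof -
      have "sweedler r (\<lambda>m d\<^sub>2. \<epsilon> m * \<beta> (p * c\<^sub>1 * S d\<^sub>2) q) = \<beta> (p * c\<^sub>1 * S r) q" for r c\<^sub>1
        by (rule sweedler_counit_left) (intro multilinear_intros \<beta>')
      then show ?thesis by (simp add: mult.assoc)
    qed
    also have "\<dots> = \<epsilon> b * \<beta> (p * 1) q"
      by (rule sweedler_antipode_right) (intro multilinear_intros \<beta>')
    finally show ?thesis by simp
  qed
  define G where "G b y z = sweedler b (\<lambda>d\<^sub>1 d\<^sub>2. \<beta> (y * S d\<^sub>2) (z * S d\<^sub>1))" for b y z
  have G: "bilinear_form (G b)" for b
    unfolding G_def by (intro multilinear_intros \<beta>')
  have "sweedler (S x) \<beta> = sweedler x (\<lambda>a b. sweedler (S a) \<beta> * \<epsilon> b)"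
    by (rule sweedler_counit_right[symmetric]) (intro multilinear_intros \<beta>)
  also have "\<dots> = sweedler x (\<lambda>a b. sweedler (S a) (\<lambda>p q. T p q b))"
    by (simp add: T sweedler_const_mult mult.commute)
  also have "\<dots> = sweedler x (\<lambda>a b. sweedler b (\<lambda>b\<^sub>1 b\<^sub>2. sweedler (S a) (\<lambda>p q. sweedler b\<^sub>1 (\<lambda>c\<^sub>1 c\<^sub>2. G b\<^sub>2 (p * c\<^sub>1) (q * c\<^sub>2)))))"
    unfolding T_def F_def G_def by (subst sweedler_swap) (rule refl)
  also have "\<dots> = sweedler x (\<lambda>a b. sweedler b (\<lambda>b\<^sub>1 b\<^sub>2. sweedler (S a * b\<^sub>1) (G b\<^sub>2)))"
    by (simp add: sweedler_mult[OF G])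
  also have "\<dots> = sweedler x (\<lambda>u b\<^sub>2. sweedler u (\<lambda>a b\<^sub>1. sweedler (S a * b\<^sub>1) (G b\<^sub>2)))"
    unfolding G_def by (rule sweedler_coassoc[symmetric]) (intro multilinear_intros \<beta>')
  also have "\<dots> = sweedler x (\<lambda>u b\<^sub>2. \<epsilon> u * sweedler 1 (G b\<^sub>2))"
  proof -
    have "sweedler u (\<lambda>a b\<^sub>1. sweedler (S a * b\<^sub>1) (G b\<^sub>2)) = \<epsilon> u * sweedler 1 (G b\<^sub>2)" for u b\<^sub>2
      by (rule sweedler_antipode_left[OF linear_form_sweedler[OF G]])
    then show ?thesis by simp
  qed
  also have "\<dots> = sweedler x (\<lambda>u b\<^sub>2. \<epsilon> u * G b\<^sub>2 1 1)"
    by (simp add: sweedler_one[OF G])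
  also have "\<dots> = G x 1 1"
    unfolding G_def by (rule sweedler_counit_left) (intro multilinear_intros \<beta>')
  also have "\<dots> = sweedler x (\<lambda>a b. \<beta> (S b) (S a))"
    by (simp add: G_def)
  finally show ?thesis .
qed

end

section \<open>Integrals\<close>

text \<open>In the dual algebra \<open>c \<mu> = c(1) \<mu>\<close>, so \<open>\<mu>\<close> is a left integral. That it can be normalized to
  \<open>\<mu> 1 = 1\<close> is what distinguishes the cosemisimple case.\<close>

locale hopf_algebra_integral = hopf_algebra scale \<Delta> \<epsilon> S
  for scale :: "'k::field \<Rightarrow> 'h::ring_1 \<Rightarrow> 'h"  (infixr \<open>*s\<close> 75)
    and \<Delta> :: "'h \<Rightarrow> ('h \<times> 'h) list"
    and \<epsilon> :: "'h \<Rightarrow> 'k"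
    and S :: "'h \<Rightarrow> 'h" +
  fixes \<mu> :: "'h \<Rightarrow> 'k"
  assumes integral_form: "linear_form \<mu>"
    and integral_one: "\<mu> 1 = 1"
    and integral_left: "linear_form c \<Longrightarrow> sweedler x (\<lambda>a b. c a * \<mu> b) = \<mu> x * c 1"
begin

lemmas integral_intros = linear_form_comp[OF integral_form]

text \<open>The form \<open>b(x, y) = \<mu> (x * S y)\<close> satisfies \<open>x\<^sub>1 b(x\<^sub>2, y) = b(x, y\<^sub>1) y\<^sub>2\<close>. Insert
  \<open>\<mu>(z) 1 = z\<^sub>1 \<mu>(z\<^sub>2)\<close> for \<open>z = x S(y\<^sub>1)\<close> on the right; since \<open>S\<close> reverses the comultiplication this
  gives \<open>x\<^sub>1 S(y\<^sub>2) y\<^sub>3 \<mu>(x\<^sub>2 S(y\<^sub>1))\<close>, and \<open>S(y\<^sub>2) y\<^sub>3\<close> cancels.\<close>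

lemma integral_balanced:
  assumes c: "linear_form c"
  shows "sweedler x (\<lambda>a b. c a * \<mu> (b * S y)) = sweedler y (\<lambda>a b. \<mu> (x * S a) * c b)"
proof -
  note c' = linear_form_comp[OF c] integral_intros
  have "sweedler y (\<lambda>a b. \<mu> (x * S a) * c b) =
      sweedler y (\<lambda>a b. sweedler x (\<lambda>x\<^sub>1 x\<^sub>2. sweedler a (\<lambda>a\<^sub>1 a\<^sub>2. c (x\<^sub>1 * S a\<^sub>2 * b) * \<mu> (x\<^sub>2 * S a\<^sub>1))))"
  proof -
    have "\<mu> (x * S a) * c b = sweedler x (\<lambda>x\<^sub>1 x\<^sub>2. sweedler a (\<lambda>a\<^sub>1 a\<^sub>2. c (x\<^sub>1 * S a\<^sub>2 * b) * \<mu> (x\<^sub>2 * S a\<^sub>1)))" for a b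
    proof -
      have "\<mu> (x * S a) * c b = sweedler (x * S a) (\<lambda>p q. c (p * b) * \<mu> q)"
      proof -
        have "linear_form (\<lambda>z. c (z * b))" by (intro multilinear_intros c')
        from integral_left[OF this, of "x * S a"] show ?thesis by simp
      qed
      also have "\<dots> = sweedler x (\<lambda>x\<^sub>1 x\<^sub>2. sweedler (S a) (\<lambda>s t. c (x\<^sub>1 * s * b) * \<mu> (x\<^sub>2 * t)))"
        by (rule sweedler_mult) (intro multilinear_intros c' integral_form)
      also have "\<dots> = sweedler x (\<lambda>x\<^sub>1 x\<^sub>2. sweedler a (\<lambda>a\<^sub>1 a\<^sub>2. c (x\<^sub>1 * S a\<^sub>2 * b) * \<mu> (x\<^sub>2 * S a\<^sub>1)))"
      proof -
        have "sweedler (S a) (\<lambda>s t. c (x\<^sub>1 * s * b) * \<mu> (x\<^sub>2 * t)) =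
            sweedler a (\<lambda>a\<^sub>1 a\<^sub>2. c (x\<^sub>1 * S a\<^sub>2 * b) * \<mu> (x\<^sub>2 * S a\<^sub>1))" for x\<^sub>1 x\<^sub>2
          by (rule sweedler_antipode) (intro multilinear_intros c')
        then show ?thesis by simp
      qed
      finally show ?thesis .
    qed
    then show ?thesis by simp
  qed
  also have "\<dots> = sweedler x (\<lambda>x\<^sub>1 x\<^sub>2. sweedler y (\<lambda>a b. sweedler a (\<lambda>a\<^sub>1 a\<^sub>2. c (x\<^sub>1 * S a\<^sub>2 * b) * \<mu> (x\<^sub>2 * S a\<^sub>1))))"
    by (rule sweedler_swap)
  also have "\<dots> = sweedler x (\<lambda>x\<^sub>1 x\<^sub>2. sweedler y (\<lambda>a\<^sub>1 r. sweedler r (\<lambda>a\<^sub>2 b. c (x\<^sub>1 * (S a\<^sub>2 * b)) * \<mu> (x\<^sub>2 * S a\<^sub>1))))"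
  proof -
    have "sweedler y (\<lambda>a b. sweedler a (\<lambda>a\<^sub>1 a\<^sub>2. c (x\<^sub>1 * (S a\<^sub>2 * b)) * \<mu> (x\<^sub>2 * S a\<^sub>1))) =
        sweedler y (\<lambda>a\<^sub>1 r. sweedler r (\<lambda>a\<^sub>2 b. c (x\<^sub>1 * (S a\<^sub>2 * b)) * \<mu> (x\<^sub>2 * S a\<^sub>1)))" for x\<^sub>1 x\<^sub>2
      by (rule sweedler_coassoc) (intro multilinear_intros c')
    then show ?thesis by (simp add: mult.assoc)
  qed
  also have "\<dots> = sweedler x (\<lambda>x\<^sub>1 x\<^sub>2. sweedler y (\<lambda>a\<^sub>1 r. \<mu> (x\<^sub>2 * S a\<^sub>1) * \<epsilon> r) * c x\<^sub>1)"
  proof -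
    have "sweedler r (\<lambda>a\<^sub>2 b. c (x\<^sub>1 * (S a\<^sub>2 * b))) = \<epsilon> r * c x\<^sub>1" for r x\<^sub>1
    proof -
      have "linear_form (\<lambda>z. c (x\<^sub>1 * z))" by (intro multilinear_intros c')
      from sweedler_antipode_left[OF this, of r] show ?thesis by simp
    qed
    then have "sweedler r (\<lambda>a\<^sub>2 b. c (x\<^sub>1 * (S a\<^sub>2 * b)) * \<mu> (x\<^sub>2 * S a\<^sub>1)) = (\<mu> (x\<^sub>2 * S a\<^sub>1) * \<epsilon> r) * c x\<^sub>1"
      for r x\<^sub>1 x\<^sub>2 a\<^sub>1
      by (simp add: sweedler_mult_const)
    then show ?thesis by (simp only:) (simp only: sweedler_mult_const)
  qed
  also have "\<dots> = sweedler x (\<lambda>a b. c a * \<mu> (b * S y))"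
  proof -
    have "sweedler y (\<lambda>a\<^sub>1 r. \<mu> (x\<^sub>2 * S a\<^sub>1) * \<epsilon> r) = \<mu> (x\<^sub>2 * S y)" for x\<^sub>2
      by (rule sweedler_counit_right) (intro multilinear_intros c')
    then show ?thesis by (simp add: mult.commute)
  qed
  finally show ?thesis by simp
qed

text \<open>The form \<open>\<mu> \<circ> S\<close> is a right integral with value \<open>1\<close> at \<open>1\<close>. Evaluating the convolution product of
  \<open>\<mu> \<circ> S\<close> and \<open>\<mu>\<close> by either integral property gives \<open>\<mu> \<circ> S\<close> and \<open>\<mu>\<close>, respectively.\<close>

lemma integral_antipode: "\<mu> (S x) = \<mu> x"
proof -
  \<comment> \<open>The left integral property at \<open>S x\<close>. To remove \<open>S\<close> from the second leg, which need not be
    onto, the identity is convolved with the identity map on the right.\<close>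
  have 1: "sweedler x (\<lambda>a b. \<mu> (S a) * c (S b)) = \<mu> (S x) * c 1" if c: "linear_form c" for c x
    using sweedler_antipode[OF bilinear_form_mult[OF c integral_form], of x] integral_left[OF c, of "S x"]
    by (simp add: mult.commute)
  have 2: "sweedler x (\<lambda>a b. \<mu> (S a) * c b) = \<mu> (S x) * c 1" if c: "linear_form c" for c
  proof -
    note c' = linear_form_comp[OF c] integral_intros
    have "sweedler x (\<lambda>a b. \<mu> (S a) * c b) = sweedler x (\<lambda>u d. sweedler u (\<lambda>a b. \<mu> (S a) * c (S b * d)))"
    proof -
      have "sweedler u (\<lambda>a b. \<mu> (S a) * c (S b * d)) = \<mu> (S u) * c d" for u d
      proof -
        have "linear_form (\<lambda>z. c (z * d))" by (intro multilinear_intros c')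
        from 1[OF this, of u] show ?thesis by simp
      qed
      then show ?thesis by simp
    qed
    also have "\<dots> = sweedler x (\<lambda>a r. sweedler r (\<lambda>b d. \<mu> (S a) * c (S b * d)))"
      by (rule sweedler_coassoc) (intro multilinear_intros c' c)
    also have "\<dots> = sweedler x (\<lambda>a r. \<mu> (S a) * \<epsilon> r) * c 1"
      by (simp add: sweedler_const_mult sweedler_antipode_left[OF c] flip: sweedler_mult_const mult.assoc)
    also have "sweedler x (\<lambda>a r. \<mu> (S a) * \<epsilon> r) = \<mu> (S x)"
      by (rule sweedler_counit_right) (intro multilinear_intros c')
    finally show ?thesis .
  qed
  have "sweedler x (\<lambda>a b. \<mu> (S a) * \<mu> b) = \<mu> x * \<mu> (S 1)"
    by (rule integral_left) (intro multilinear_intros integral_intros)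
  then show ?thesis using 2[OF integral_form] by (simp add: integral_one)
qed

text \<open>Let \<open>J\<close> be the set of all \<open>z\<close> with \<open>\<mu> (H z) = 0\<close>. The identity \<open>z\<^sub>1 \<mu>(x z\<^sub>2) = S(x\<^sub>1) \<mu>(x\<^sub>2 z)\<close>
  shows \<open>\<Delta> J \<subseteq> H \<otimes> J\<close>. As \<open>J\<close> is a left ideal, \<open>\<epsilon> z = \<mu> (S(z\<^sub>1) z\<^sub>2) = 0\<close> for \<open>z \<in> J\<close>; and since \<open>J\<close> is
  stable under the right action, \<open>c z = \<epsilon> (z \<leftharpoonup> c) = 0\<close> for every linear form \<open>c\<close>.\<close>

lemma integral_faithful:
  assumes z: "\<And>x. \<mu> (x * z) = 0"
  shows "z = 0"
proof -
  have shift: "sweedler z (\<lambda>a b. c a * \<mu> (x * b)) = sweedler x (\<lambda>a b. c (S a) * \<mu> (b * z))"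
    if c: "linear_form c" for c x z
  proof -
    note c' = linear_form_comp[OF c] integral_intros
    have "sweedler x (\<lambda>a b. c (S a) * \<mu> (b * z)) =
        sweedler x (\<lambda>a b. sweedler b (\<lambda>b\<^sub>1 b\<^sub>2. sweedler z (\<lambda>z\<^sub>1 z\<^sub>2. c (S a * b\<^sub>1 * z\<^sub>1) * \<mu> (b\<^sub>2 * z\<^sub>2))))"
    proof -
      have "c (S a) * \<mu> (b * z) = sweedler b (\<lambda>b\<^sub>1 b\<^sub>2. sweedler z (\<lambda>z\<^sub>1 z\<^sub>2. c (S a * b\<^sub>1 * z\<^sub>1) * \<mu> (b\<^sub>2 * z\<^sub>2)))" for a b
      proof -
        have "c (S a) * \<mu> (b * z) = sweedler (b * z) (\<lambda>p q. c (S a * p) * \<mu> q)"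
        proof -
          have "linear_form (\<lambda>w. c (S a * w))" by (intro multilinear_intros c')
          from integral_left[OF this, of "b * z"] show ?thesis by (simp add: mult.commute)
        qed
        also have "\<dots> = sweedler b (\<lambda>b\<^sub>1 b\<^sub>2. sweedler z (\<lambda>z\<^sub>1 z\<^sub>2. c (S a * (b\<^sub>1 * z\<^sub>1)) * \<mu> (b\<^sub>2 * z\<^sub>2)))"
          by (rule sweedler_mult) (intro multilinear_intros c' integral_form)
        finally show ?thesis by (simp add: mult.assoc)
      qed
      then show ?thesis by simp
    qed
    also have "\<dots> = sweedler x (\<lambda>u b\<^sub>2. sweedler u (\<lambda>a b\<^sub>1. sweedler z (\<lambda>z\<^sub>1 z\<^sub>2. c (S a * b\<^sub>1 * z\<^sub>1) * \<mu> (b\<^sub>2 * z\<^sub>2))))"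
      by (rule sweedler_coassoc[symmetric]) (intro multilinear_intros c')
    also have "\<dots> = sweedler x (\<lambda>u b\<^sub>2. \<epsilon> u * sweedler z (\<lambda>z\<^sub>1 z\<^sub>2. c (1 * z\<^sub>1) * \<mu> (b\<^sub>2 * z\<^sub>2)))"
    proof -
      have "sweedler u (\<lambda>a b\<^sub>1. sweedler z (\<lambda>z\<^sub>1 z\<^sub>2. c (S a * b\<^sub>1 * z\<^sub>1) * \<mu> (b\<^sub>2 * z\<^sub>2))) =
          \<epsilon> u * sweedler z (\<lambda>z\<^sub>1 z\<^sub>2. c (1 * z\<^sub>1) * \<mu> (b\<^sub>2 * z\<^sub>2))" for u b\<^sub>2
        by (rule sweedler_antipode_left[of "\<lambda>w. sweedler z (\<lambda>z\<^sub>1 z\<^sub>2. c (w * z\<^sub>1) * \<mu> (b\<^sub>2 * z\<^sub>2))"])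
          (intro multilinear_intros c')
      then show ?thesis by simp
    qed
    also have "\<dots> = sweedler z (\<lambda>z\<^sub>1 z\<^sub>2. c (1 * z\<^sub>1) * \<mu> (x * z\<^sub>2))"
      by (rule sweedler_counit_left) (intro multilinear_intros c')
    finally show ?thesis by simp
  qed
  have comodule: "sweedler z (\<lambda>a b. c a * \<mu> (x * b)) = 0"
    if "\<And>x. \<mu> (x * z) = 0" "linear_form c" for c x z
    using shift[OF that(2), of z x] that(1) sweedler_const_mult[of x 0 "\<lambda>a b. 0"] by simp
  have counit_0: "\<epsilon> z = 0" if z: "\<And>x. \<mu> (x * z) = 0" for z
  proof -
    have "sweedler z (\<lambda>a b. \<mu> (S a * b)) = 0"
      by (rule sweedler_eq_0) (intro multilinear_intros integral_intros comodule z | assumption)+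
    then show ?thesis by (simp add: sweedler_antipode_left integral_form integral_one)
  qed
  show ?thesis
  proof (rule linear_forms_eqI)
    fix c assume c: "linear_form c"
    have "\<mu> (x * (z \<leftharpoonup> c)) = 0" for x
    proof -
      have "linear_form (\<lambda>w. \<mu> (x * w))" by (intro multilinear_intros integral_intros)
      from form_right_act[OF this] show ?thesis using comodule[OF z c] by simp
    qed
    then have "c z = 0" using counit_0 counit_right_act[OF c] by metis
    then show "c z = c 0" by (simp add: linear_form_zero[OF c])
  qed
qed

text \<open>If \<open>S t = 0\<close> then \<open>\<mu> (x * t) = \<mu> (S t * S x) = 0\<close> for all \<open>x\<close>.\<close>

lemma antipode_injective: "S t = 0 \<Longrightarrow> t = 0"
  by (rule integral_faithful) (metis antipode_mult integral_antipode linear_form_zero[OF integral_form] mult_zero_left)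

text \<open>The square of the antipode is the Nakayama automorphism of the form \<open>\<mu> (x * S y)\<close>.\<close>

lemma integral_nakayama: "\<mu> (x * S y) = \<mu> (S (S y) * S x)"
  using integral_antipode[of "x * S y"] by (simp add: antipode_mult)

text \<open>For \<open>v = \<mu> (- * S t)\<close> this says \<open>S\<^sup>2 (v \<rightharpoonup> x) = x \<leftharpoonup> v\<close>. Balancedness moves both sums from \<open>x\<close> to \<open>t\<close>,
  on the right after the Nakayama automorphism has brought \<open>t\<close> into the first argument. The two
  sums over \<open>t\<close> then differ by the order of the tensor factors.\<close>

lemma cocommutative_twist:
  assumes t: "cocommutative t" and c: "linear_form c"
  shows "sweedler x (\<lambda>a b. c (S (S a)) * \<mu> (b * S t)) = sweedler x (\<lambda>a b. \<mu> (a * S t) * c b)"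
proof -
  note c' = linear_form_comp[OF c] integral_intros
  have cS: "linear_form (\<lambda>x. c (S (S x)))" by (intro multilinear_intros c')
  have mS: "linear_form (\<lambda>a. \<mu> (x * S a))" by (intro multilinear_intros c')
  have "sweedler x (\<lambda>a b. c (S (S a)) * \<mu> (b * S t)) = sweedler t (\<lambda>a b. \<mu> (x * S a) * c (S (S b)))"
    by (rule integral_balanced[OF cS])
  also have "\<dots> = sweedler t (\<lambda>a b. c (S (S a)) * \<mu> (x * S b))"
    using t mS cS unfolding cocommutative_def convolution_sweedler by blast
  also have "\<dots> = sweedler t (\<lambda>a b. c (S (S a)) * \<mu> (S (S b) * S x))"
    using integral_nakayama by simp
  also have "\<dots> = sweedler (S t) (\<lambda>a b. c (S b) * \<mu> (S a * S x))"
    by (rule sweedler_antipode[symmetric]) (intro multilinear_intros c')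
  also have "\<dots> = sweedler (S (S t)) (\<lambda>a b. c a * \<mu> (b * S x))"
    by (rule sweedler_antipode[symmetric]) (intro multilinear_intros c' c)
  also have "\<dots> = sweedler x (\<lambda>a b. \<mu> (S (S t) * S a) * c b)"
    by (rule integral_balanced[OF c])
  also have "\<dots> = sweedler x (\<lambda>a b. \<mu> (a * S t) * c b)"
    using integral_nakayama by simp
  finally show ?thesis .
qed

end

section \<open>Cocommutative elements of simple coalgebras\<close>

context coalgebra
begin

text \<open>The image of \<open>H\<^sup>* \<otimes> H\<^sup>*\<close> in the linear operators on \<open>H\<close>; the invariant subspaces are the
  subcoalgebras.\<close>

inductive_set bimodule_ops :: "('h \<Rightarrow> 'h) set" where
  act: "linear_form c \<Longrightarrow> linear_form d \<Longrightarrow> (\<lambda>x. (c \<rightharpoonup> x) \<leftharpoonup> d) \<in> bimodule_ops"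
| add: "T \<in> bimodule_ops \<Longrightarrow> U \<in> bimodule_ops \<Longrightarrow> (\<lambda>x. T x + U x) \<in> bimodule_ops"

lemma bimodule_ops_linear: "T \<in> bimodule_ops \<Longrightarrow> linear_op T"
  by (induction rule: bimodule_ops.induct)
    (simp_all add: linear_op_plus linear_op_comp[OF linear_op_right_act linear_op_left_act])

lemma bimodule_ops_subcoalgebra: "T \<in> bimodule_ops \<Longrightarrow> subcoalgebra C \<Longrightarrow> x \<in> C \<Longrightarrow> T x \<in> C"
  by (induction rule: bimodule_ops.induct)
    (simp_all add: left_act_subcoalgebra right_act_subcoalgebra subspace_add subcoalgebra_subspace)

lemma left_act_in_bimodule_ops: "linear_form c \<Longrightarrow> (\<lambda>x. c \<rightharpoonup> x) \<in> bimodule_ops"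
  using bimodule_ops.act[of c \<epsilon>] counit_form by simp

lemma right_act_in_bimodule_ops: "linear_form d \<Longrightarrow> (\<lambda>x. x \<leftharpoonup> d) \<in> bimodule_ops"
  using bimodule_ops.act[of \<epsilon> d] counit_form by simp

lemma bimodule_ops_id: "(\<lambda>x. x) \<in> bimodule_ops"
  using left_act_in_bimodule_ops[OF counit_form] by simp

lemma left_act_cmult: "linear_form c \<Longrightarrow> (\<lambda>x. r * c x) \<rightharpoonup> x = r *s (c \<rightharpoonup> x)"
  by (rule linear_forms_eqI)
    (simp add: form_left_act linear_form_scale mult.left_commute sweedler_const_mult)

lemma bimodule_ops_scale: "T \<in> bimodule_ops \<Longrightarrow> (\<lambda>x. r *s T x) \<in> bimodule_ops"
proof (induction rule: bimodule_ops.induct)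
  case (act c d)
  have "r *s ((c \<rightharpoonup> x) \<leftharpoonup> d) = ((\<lambda>x. r * c x) \<rightharpoonup> x) \<leftharpoonup> d" for x
    using act by (simp add: left_act_cmult linear_op_scale[OF linear_op_right_act])
  then show ?case using bimodule_ops.act[OF linear_form_cmult[OF act(1)] act(2)] by simp
next
  case (add T U)
  then show ?case using bimodule_ops.add by (simp add: scale_right_distrib)
qed

lemma bimodule_ops_diff:
  "T \<in> bimodule_ops \<Longrightarrow> U \<in> bimodule_ops \<Longrightarrow> (\<lambda>x. T x - U x) \<in> bimodule_ops"
  using bimodule_ops.add[OF _ bimodule_ops_scale[of U "- 1"]] by simp

lemma bimodule_ops_comp:
  assumes "T \<in> bimodule_ops" "U \<in> bimodule_ops"
  shows "(\<lambda>x. T (U x)) \<in> bimodule_ops"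
  using assms(1)
proof (induction rule: bimodule_ops.induct)
  case (act c d)
  show ?case
    using assms(2)
  proof (induction rule: bimodule_ops.induct)
    case (act c' d')
    have "(c \<rightharpoonup> ((c' \<rightharpoonup> x) \<leftharpoonup> d')) \<leftharpoonup> d = (convolution c c' \<rightharpoonup> x) \<leftharpoonup> convolution d' d" for x
      using act \<open>linear_form c\<close> \<open>linear_form d\<close>
      by (simp flip: left_act_right_act left_act_left_act right_act_right_act)
    then show ?case
      using bimodule_ops.act[OF linear_form_convolution linear_form_convolution] act
        \<open>linear_form c\<close> \<open>linear_form d\<close> by simp
  next
    case (add T U)
    then show ?case using bimodule_ops.add act
      by (simp add: linear_op_add[OF linear_op_left_act] linear_op_add[OF linear_op_right_act])
  qed
next
  case (add T U)
  then show ?case using bimodule_ops.add by simp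
qed

text \<open>The orbit of \<open>x\<close> is a nonzero subcoalgebra inside \<open>C\<close>.\<close>

lemma bimodule_ops_transitive:
  assumes C: "simple_subcoalgebra C" and x: "x \<in> C" "x \<noteq> 0" and y: "y \<in> C"
  shows "\<exists>T\<in>bimodule_ops. T x = y"
proof -
  let ?D = "(\<lambda>T. T x) ` bimodule_ops"
  have sub: "subcoalgebra C" using C by (simp add: simple_subcoalgebra_def)
  have "subspace ?D"
  proof (rule subspaceI)
    show "0 \<in> ?D" using bimodule_ops_diff[OF bimodule_ops_id bimodule_ops_id] by force
    show "u + w \<in> ?D" if uw: "u \<in> ?D" "w \<in> ?D" for u w
    proof -
      obtain T U where "T \<in> bimodule_ops" "U \<in> bimodule_ops" "u = T x" "w = U x" using uw by blast
      then show ?thesis using bimodule_ops.add[of T U] by (intro image_eqI[of _ _ "\<lambda>x. T x + U x"]) auto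
    qed
    show "r *s u \<in> ?D" if u: "u \<in> ?D" for r u
    proof -
      obtain T where "T \<in> bimodule_ops" "u = T x" using u by blast
      then show ?thesis using bimodule_ops_scale[of T r] by (intro image_eqI[of _ _ "\<lambda>x. r *s T x"]) auto
    qed
  qed
  moreover have stable: "U u \<in> ?D" if U: "U \<in> bimodule_ops" and u: "u \<in> ?D" for U u
  proof -
    obtain T where "T \<in> bimodule_ops" "u = T x" using u by blast
    then show ?thesis using bimodule_ops_comp[OF U, of T] by (intro image_eqI[of _ _ "\<lambda>x. U (T x)"]) auto
  qed
  ultimately have "subcoalgebra ?D"
    using stable[OF left_act_in_bimodule_ops] stable[OF right_act_in_bimodule_ops]
    by (intro subcoalgebraI_stable)
  moreover have "?D \<subseteq> C" using bimodule_ops_subcoalgebra[OF _ sub x(1)] by blast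
  moreover have "x \<in> ?D" using bimodule_ops_id by force
  ultimately have "?D = C" using C x(2) unfolding simple_subcoalgebra_def by blast
  then show ?thesis using y by blast
qed

text \<open>All elements \<open>(c \<rightharpoonup> x) \<leftharpoonup> d\<close> lie in the span of the finitely many middle factors \<open>X\<close> of
  \<open>x\<^sub>1 \<otimes> x\<^sub>2 \<otimes> x\<^sub>3\<close>, and for \<open>x \<noteq> 0\<close> such elements span \<open>C\<close>.\<close>

lemma simple_subcoalgebra_finite:
  assumes C: "simple_subcoalgebra C"
  shows "\<exists>B. finite B \<and> B \<subseteq> C \<and> C \<subseteq> span B"
proof -
  have sub: "subspace C" "C \<noteq> {0}"
    using C by (auto simp: simple_subcoalgebra_def subcoalgebra_subspace)
  then obtain x where x: "x \<in> C" "x \<noteq> 0" using subspace_0 by blast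
  define X where "X = (\<Union>(a, b)\<in>set (\<Delta> x). snd ` set (\<Delta> a))"
  have sum_list_span: "sum_list (map f l) \<in> span X" if "\<forall>p\<in>set l. f p \<in> span X"
    for f and l :: "('h \<times> 'h) list"
    using that by (induction l) (auto intro: span_add span_zero)
  have "T x \<in> span X" if "T \<in> bimodule_ops" for T
    using that
  proof (induction rule: bimodule_ops.induct)
    case (act c d)
    have right: "a \<leftharpoonup> d \<in> span X" if ab: "(a, b) \<in> set (\<Delta> x)" for a b
    proof -
      have "q \<in> X" if "(p, q) \<in> set (\<Delta> a)" for p q
        using ab that unfolding X_def by (intro UN_I[of "(a, b)"]) (auto intro!: image_eqI[of _ _ "(p, q)"])
      then show ?thesis
        unfolding right_act_def by (intro sum_list_span) (auto intro: span_scale[OF span_base])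
    qed
    have "(c \<rightharpoonup> x) \<leftharpoonup> d = (\<Sum>(a, b)\<leftarrow>\<Delta> x. c b *s (a \<leftharpoonup> d))"
      unfolding left_act_def case_prod_unfold linear_op_sum_list[OF linear_op_right_act[OF act(2)]]
      by (simp add: linear_op_scale[OF linear_op_right_act[OF act(2)]])
    also have "\<dots> \<in> span X"
      using right by (intro sum_list_span) (auto intro!: span_scale)
    finally show ?case .
  next
    case (add T U)
    then show ?case by (simp add: span_add)
  qed
  then have CX: "C \<subseteq> span X" using bimodule_ops_transitive[OF C x] by blast
  obtain B where B: "B \<subseteq> C" "independent B" "C \<subseteq> span B"
    using maximal_independent_subset by blast
  have "finite X" by (auto simp: X_def)
  then have "finite B" using independent_span_bound[OF _ B(2)] B(1) CX by blast
  then show ?thesis using B by blast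
qed

lemma simple_subcoalgebra_irreducible:
  assumes C: "simple_subcoalgebra C"
  shows "irreducible_operators scale C bimodule_ops"
proof (intro irreducible_operators.intro irreducible_operators_axioms.intro)
  have sub: "subcoalgebra C" using C by (simp add: simple_subcoalgebra_def)
  then show "subspace C" by (rule subcoalgebra_subspace)
  show "C \<noteq> {0}" using C by (simp add: simple_subcoalgebra_def)
  show "T x \<in> C" if "T \<in> bimodule_ops" "x \<in> C" for T x
    using bimodule_ops_subcoalgebra[OF that(1) sub that(2)] .
qed (fact linear_forms_axioms bimodule_ops_linear bimodule_ops_id bimodule_ops.add bimodule_ops_diff bimodule_ops_comp
    bimodule_ops_transitive[OF C] simple_subcoalgebra_finite[OF C])+

text \<open>An element \<open>z\<close> of the commutant is itself an operator of the bimodule, namely the left action of a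
  linear form that extends \<open>\<epsilon> \<circ> z\<close>; every other element of the commutant therefore commutes with it.\<close>

lemma simple_subcoalgebra_commutant:
  assumes C: "simple_subcoalgebra C"
    and z: "z \<in> irreducible_operators.commutant C bimodule_ops"
    and z': "z' \<in> irreducible_operators.commutant C bimodule_ops" and x: "x \<in> C"
  shows "z (z' x) = z' (z x)"
proof -
  interpret irreducible_operators scale C bimodule_ops
    by (rule simple_subcoalgebra_irreducible[OF C])
  have sub: "subcoalgebra C" using C by (simp add: simple_subcoalgebra_def)
  have "\<exists>\<zeta>. linear_form \<zeta> \<and> (\<forall>x\<in>C. \<zeta> x = \<epsilon> (z x))"
  proof (rule linear_form_extend)
    show "subspace C" by (rule V)
    show "\<epsilon> (z (x + y)) = \<epsilon> (z x) + \<epsilon> (z y)" if "x \<in> C" "y \<in> C" for x y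
      using commutant_add[OF z that] by (simp add: linear_form_add[OF counit_form])
    show "\<epsilon> (z (r *s x)) = r * \<epsilon> (z x)" if "x \<in> C" for r x
      using commutant_commute[OF z bimodule_ops_scale[OF bimodule_ops_id] that]
      by (simp add: linear_form_scale[OF counit_form])
  qed
  then obtain \<zeta> where \<zeta>: "linear_form \<zeta>" "\<And>x. x \<in> C \<Longrightarrow> \<zeta> x = \<epsilon> (z x)" by blast
  have z_act: "z y = \<zeta> \<rightharpoonup> y" if y: "y \<in> C" for y
  proof (rule linear_forms_eqI)
    fix c assume c: "linear_form c"
    have "c (\<zeta> \<rightharpoonup> y) = \<zeta> (y \<leftharpoonup> c)" by (simp add: form_left_act[OF c] form_right_act[OF \<zeta>(1)])
    also have "\<dots> = \<epsilon> (z (y \<leftharpoonup> c))" using \<zeta>(2) right_act_subcoalgebra[OF sub y c] by simp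
    also have "\<dots> = \<epsilon> (z y \<leftharpoonup> c)"
      using commutant_commute[OF z right_act_in_bimodule_ops[OF c] y] by simp
    also have "\<dots> = c (z y)" by (rule counit_right_act[OF c])
    finally show "c (z y) = c (\<zeta> \<rightharpoonup> y)" by simp
  qed
  have "z (z' x) = \<zeta> \<rightharpoonup> z' x" using z_act commutant_closed[OF z' x] by simp
  also have "\<dots> = z' (\<zeta> \<rightharpoonup> x)"
    using commutant_commute[OF z' left_act_in_bimodule_ops[OF \<zeta>(1)] x] by simp
  finally show ?thesis using z_act[OF x] by simp
qed

text \<open>Let \<open>\<phi>\<close> be a nonzero trace on the operators of the bimodule \<open>C\<close>. As the left and the right action
  commute, \<open>c \<mapsto> \<phi> (x \<mapsto> (c \<rightharpoonup> x) \<leftharpoonup> d)\<close> is a trace on the dual algebra for each \<open>d\<close>, and it is nonzero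
  for some \<open>d\<close>. If \<open>\<phi> T = \<Sum> g(T v)\<close>, it is evaluation at \<open>t = \<Sum> (v \<leftharpoonup> d) \<leftharpoonup> g\<close>.\<close>

lemma cocommutative_exists:
  assumes C: "simple_subcoalgebra C"
  shows "\<exists>t\<in>C. t \<noteq> 0 \<and> cocommutative t"
proof -
  interpret irreducible_operators scale C bimodule_ops
    by (rule simple_subcoalgebra_irreducible[OF C])
  have sub: "subcoalgebra C" using C by (simp add: simple_subcoalgebra_def)
  obtain gvs T\<^sub>0 where gvs: "\<And>g v. (g, v) \<in> set gvs \<Longrightarrow> linear_form g \<and> v \<in> C"
    and trace: "\<And>T U. T \<in> bimodule_ops \<Longrightarrow> U \<in> bimodule_ops \<Longrightarrow>
      (\<Sum>(g, v)\<leftarrow>gvs. g (T (U v))) = (\<Sum>(g, v)\<leftarrow>gvs. g (U (T v)))"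
    and T\<^sub>0: "T\<^sub>0 \<in> bimodule_ops" "(\<Sum>(g, v)\<leftarrow>gvs. g (T\<^sub>0 v)) \<noteq> 0"
    using trace_exists simple_subcoalgebra_commutant[OF C] by blast
  have "\<exists>c d. linear_form c \<and> linear_form d \<and> (\<Sum>(g, v)\<leftarrow>gvs. g ((c \<rightharpoonup> v) \<leftharpoonup> d)) \<noteq> 0"
  proof (rule ccontr)
    assume none: "\<not> ?thesis"
    have "(\<Sum>(g, v)\<leftarrow>gvs. g (T v)) = 0" if "T \<in> bimodule_ops" for T
      using that
    proof (induction rule: bimodule_ops.induct)
      case (act c d)
      then show ?case using none by blast
    next
      case (add T U)
      have "(\<Sum>(g, v)\<leftarrow>gvs. g (T v + U v)) = (\<Sum>(g, v)\<leftarrow>gvs. g (T v) + g (U v))"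
        using gvs by (intro arg_cong[where f = sum_list] map_cong) (auto simp: linear_form_add)
      then show ?case using add by (simp add: case_prod_unfold sum_list_addf)
    qed
    then show False using T\<^sub>0 by blast
  qed
  then obtain c\<^sub>0 d where c\<^sub>0: "linear_form c\<^sub>0" and d: "linear_form d"
    and nz: "(\<Sum>(g, v)\<leftarrow>gvs. g ((c\<^sub>0 \<rightharpoonup> v) \<leftharpoonup> d)) \<noteq> 0"
    by blast
  define t where "t = (\<Sum>(g, v)\<leftarrow>gvs. v \<leftharpoonup> d \<leftharpoonup> g)"
  have ct: "c t = (\<Sum>(g, v)\<leftarrow>gvs. g ((c \<rightharpoonup> v) \<leftharpoonup> d))" if c: "linear_form c" for c
  proof -
    have "c t = (\<Sum>(g, v)\<leftarrow>gvs. c (v \<leftharpoonup> d \<leftharpoonup> g))"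
      unfolding t_def by (simp add: linear_form_sum_list[OF c] case_prod_unfold)
    also have "\<dots> = (\<Sum>(g, v)\<leftarrow>gvs. g ((c \<rightharpoonup> v) \<leftharpoonup> d))"
      using gvs by (intro arg_cong[where f = sum_list] map_cong)
        (auto simp: left_act_right_act c d form_right_act[OF c] form_left_act)
    finally show ?thesis .
  qed
  have "(\<Sum>(g, v)\<leftarrow>l. v \<leftharpoonup> d \<leftharpoonup> g) \<in> C" if "set l \<subseteq> set gvs" for l
    using that
  proof (induction l)
    case Nil
    show ?case by (simp add: subspace_0[OF V(1)])
  next
    case (Cons gv l)
    obtain g v where gv: "gv = (g, v)" by (cases gv)
    then have "v \<leftharpoonup> d \<leftharpoonup> g \<in> C"
      using gvs Cons.prems d by (intro right_act_subcoalgebra[OF sub]) auto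
    then show ?case using Cons gv by (simp add: subspace_add[OF V(1)])
  qed
  then have "t \<in> C" unfolding t_def by blast
  moreover have "t \<noteq> 0" using ct[OF c\<^sub>0] nz linear_form_zero[OF c\<^sub>0] by auto
  moreover have "convolution c c' t = convolution c' c t" if c: "linear_form c" "linear_form c'" for c c'
  proof -
    have "convolution c c' t = (\<Sum>(g, v)\<leftarrow>gvs. g (c \<rightharpoonup> ((c' \<rightharpoonup> v) \<leftharpoonup> d)))"
      by (simp add: ct linear_form_convolution c d flip: left_act_left_act left_act_right_act)
    also have "\<dots> = (\<Sum>(g, v)\<leftarrow>gvs. g ((c' \<rightharpoonup> c \<rightharpoonup> v) \<leftharpoonup> d))"
      by (rule trace[OF left_act_in_bimodule_ops[OF c(1)] bimodule_ops.act[OF c(2) d]])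
    also have "\<dots> = convolution c' c t"
      by (simp add: ct linear_form_convolution c d flip: left_act_left_act)
    finally show ?thesis .
  qed
  ultimately show ?thesis unfolding cocommutative_def by blast
qed

end

section \<open>Decomposition into simple subcoalgebras\<close>

locale cosemisimple_coalgebra = coalgebra scale \<Delta> \<epsilon>
  for scale :: "'k::field \<Rightarrow> 'h::ab_group_add \<Rightarrow> 'h"  (infixr \<open>*s\<close> 75)
    and \<Delta> :: "'h \<Rightarrow> ('h \<times> 'h) list"
    and \<epsilon> :: "'h \<Rightarrow> 'k" +
  fixes \<C> :: "'h set set"
  assumes simple: "C \<in> \<C> \<Longrightarrow> simple_subcoalgebra C"
    and direct: "is_direct_sum \<C>"
begin

lemma component_subcoalgebra: "C \<in> \<C> \<Longrightarrow> subcoalgebra C"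
  using simple by (simp add: simple_subcoalgebra_def)

lemma component_subspace: "C \<in> \<C> \<Longrightarrow> subspace C"
  by (simp add: component_subcoalgebra subcoalgebra_subspace)

lemma subspace_eq_UNIV:
  assumes "subspace W" "\<And>C x. C \<in> \<C> \<Longrightarrow> x \<in> C \<Longrightarrow> x \<in> W"
  shows "x \<in> W"
  using span_minimal[of "\<Union>\<C>" W] assms direct unfolding is_direct_sum_def by auto

lemma linear_op_eqI:
  assumes "linear_op f" "linear_op g" "\<And>C x. C \<in> \<C> \<Longrightarrow> x \<in> C \<Longrightarrow> f x = g x"
  shows "f x = g x"
proof -
  have "subspace {x. f x = g x}"
    using assms(1,2) by (auto intro!: subspaceI simp: linear_op_zero linear_op_add linear_op_scale)
  from subspace_eq_UNIV[OF this] assms(3) show ?thesis by blast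
qed

text \<open>The central idempotent of the dual algebra that belongs to \<open>C\<close>: acting with it, from either side,
  is the projection onto \<open>C\<close> along the other components.\<close>

definition component_form :: "'h set \<Rightarrow> 'h \<Rightarrow> 'k" where
  "component_form C = (SOME g. linear_form g \<and>
     (\<forall>D\<in>\<C>. \<forall>x\<in>D. g x = (if D = C then \<epsilon> x else 0)))"

lemma component_form:
  shows component_form_linear: "linear_form (component_form C)"
    and component_form_on: "D \<in> \<C> \<Longrightarrow> x \<in> D \<Longrightarrow> component_form C x = (if D = C then \<epsilon> x else 0)"
proof -
  have "linear_form (\<lambda>x. if D = C then \<epsilon> x else 0)" for D
    by (cases "D = C") (simp_all add: counit_form linear_form_const_0)
  from linear_form_glue[OF direct this]
  have "\<exists>g. linear_form g \<and> (\<forall>D\<in>\<C>. \<forall>x\<in>D. g x = (if D = C then \<epsilon> x else 0))" .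
  from someI_ex[OF this]
  have "linear_form (component_form C) \<and>
      (\<forall>D\<in>\<C>. \<forall>x\<in>D. component_form C x = (if D = C then \<epsilon> x else 0))"
    unfolding component_form_def by simp
  note spec = this
  show "linear_form (component_form C)" by (rule conjunct1[OF spec])
  show "component_form C x = (if D = C then \<epsilon> x else 0)" if "D \<in> \<C>" "x \<in> D"
    by (rule bspec[OF bspec[OF conjunct2[OF spec] that(1)] that(2)])
qed

lemma component_projection_on:
  assumes D: "D \<in> \<C>" "x \<in> D"
  shows "component_form C \<rightharpoonup> x = (if D = C then x else 0)"
    and "x \<leftharpoonup> component_form C = (if D = C then x else 0)"
proof -
  note sub = component_subcoalgebra[OF D(1)]
  note form = component_form_linear[of C] component_form_on[OF D(1), of _ C]
  have "component_form C \<rightharpoonup> x = (if D = C then x else 0) \<and>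
      x \<leftharpoonup> component_form C = (if D = C then x else 0)"
  proof (cases "D = C")
    case True
    then show ?thesis
      using left_act_cong[OF sub D(2) form(1) counit_form] right_act_cong[OF sub D(2) form(1) counit_form]
        form(2) by simp
  next
    case False
    then show ?thesis
      using left_act_cong[OF sub D(2) form(1) linear_form_const_0]
        right_act_cong[OF sub D(2) form(1) linear_form_const_0]
        form(2) by (simp add: zero_left_act right_act_zero)
  qed
  then show "component_form C \<rightharpoonup> x = (if D = C then x else 0)"
    and "x \<leftharpoonup> component_form C = (if D = C then x else 0)" by simp_all
qed

lemma component_form_central: "component_form C \<rightharpoonup> x = x \<leftharpoonup> component_form C"
  by (rule linear_op_eqI[of "\<lambda>x. component_form C \<rightharpoonup> x" "\<lambda>x. x \<leftharpoonup> component_form C"])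
    (simp_all add: linear_op_left_act linear_op_right_act component_form_linear component_projection_on)

lemma component_projection_in:
  assumes "C \<in> \<C>"
  shows "component_form C \<rightharpoonup> x \<in> C"
proof -
  have "subspace {x. component_form C \<rightharpoonup> x \<in> C}"
    using component_subspace[OF assms] linear_op_left_act[OF component_form_linear, of C]
    by (auto intro!: subspaceI simp: linear_op_zero linear_op_add linear_op_scale
        subspace_0 subspace_add subspace_scale)
  moreover have "y \<in> {x. component_form C \<rightharpoonup> x \<in> C}" if "D \<in> \<C>" "y \<in> D" for D y
    using component_projection_on(1)[OF that, of C] that subspace_0[OF component_subspace[OF assms]]
    by auto
  ultimately have "x \<in> {x. component_form C \<rightharpoonup> x \<in> C}" by (rule subspace_eq_UNIV)
  then show ?thesis by simp
qed

text \<open>Every element is the sum of its projections over each sufficiently large finite set of components.\<close>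

lemma component_projections_zero:
  assumes zero: "\<And>C. C \<in> \<C> \<Longrightarrow> component_form C \<rightharpoonup> x = 0"
  shows "x = 0"
proof -
  define supports where "supports F x \<longleftrightarrow> finite F \<and> F \<subseteq> \<C> \<and>
    (\<forall>G. finite G \<longrightarrow> F \<subseteq> G \<longrightarrow> x = (\<Sum>C\<in>G. component_form C \<rightharpoonup> x))" for F x
  note lin = linear_op_left_act[OF component_form_linear]
  have "subspace {x. \<exists>F. supports F x}"
  proof (rule subspaceI)
    have "supports {} 0" by (simp add: supports_def linear_op_zero[OF lin])
    then show "0 \<in> {x. \<exists>F. supports F x}" by blast
    fix x y assume "x \<in> {x. \<exists>F. supports F x}" "y \<in> {x. \<exists>F. supports F x}"
    then obtain F F' where F: "supports F x" and F': "supports F' y" by blast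
    have "supports (F \<union> F') (x + y)"
      unfolding supports_def
    proof (intro conjI allI impI)
      show "finite (F \<union> F')" "F \<union> F' \<subseteq> \<C>" using F F' by (simp_all add: supports_def)
      fix G assume G: "finite G" "F \<union> F' \<subseteq> G"
      have "x = (\<Sum>C\<in>G. component_form C \<rightharpoonup> x)" "y = (\<Sum>C\<in>G. component_form C \<rightharpoonup> y)"
        using F F' G unfolding supports_def by simp_all
      then show "x + y = (\<Sum>C\<in>G. component_form C \<rightharpoonup> (x + y))"
        by (simp add: linear_op_add[OF lin] sum.distrib)
    qed
    then show "x + y \<in> {x. \<exists>F. supports F x}" by blast
  next
    fix r x assume "x \<in> {x. \<exists>F. supports F x}"
    then obtain F where F: "supports F x" by blast
    have "supports F (r *s x)"
      unfolding supports_def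
    proof (intro conjI allI impI)
      show "finite F" "F \<subseteq> \<C>" using F by (simp_all add: supports_def)
      fix G assume "finite G" "F \<subseteq> G"
      then have "x = (\<Sum>C\<in>G. component_form C \<rightharpoonup> x)" using F by (simp add: supports_def)
      then have "r *s x = r *s (\<Sum>C\<in>G. component_form C \<rightharpoonup> x)" by (rule arg_cong)
      also have "\<dots> = (\<Sum>C\<in>G. component_form C \<rightharpoonup> (r *s x))"
        by (simp add: linear_op_scale[OF lin] scale_sum_right)
      finally show "r *s x = (\<Sum>C\<in>G. component_form C \<rightharpoonup> (r *s x))" .
    qed
    then show "r *s x \<in> {x. \<exists>F. supports F x}" by blast
  qed
  moreover have "y \<in> {x. \<exists>F. supports F x}" if D: "D \<in> \<C>" "y \<in> D" for D y
  proof -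
    have "y = (\<Sum>C\<in>G. component_form C \<rightharpoonup> y)" if "finite G" "{D} \<subseteq> G" for G
      using that by (simp add: component_projection_on[OF D])
    then have "supports {D} y" using D(1) by (simp add: supports_def)
    then show ?thesis by blast
  qed
  ultimately have "x \<in> {x. \<exists>F. supports F x}" by (rule subspace_eq_UNIV)
  then obtain F where F: "supports F x" by blast
  then have "x = (\<Sum>C\<in>F. component_form C \<rightharpoonup> x)" by (simp add: supports_def)
  also have "\<dots> = 0" using zero F by (intro sum.neutral) (auto simp: supports_def)
  finally show ?thesis .
qed

end

section \<open>The integral of a cosemisimple Hopf algebra\<close>

locale cosemisimple_hopf_algebra =
  hopf_algebra scale \<Delta> \<epsilon> S + cosemisimple_coalgebra scale \<Delta> \<epsilon> \<C>
  for scale :: "'k::field \<Rightarrow> 'h::ring_1 \<Rightarrow> 'h"  (infixr \<open>*s\<close> 75)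
    and \<Delta> :: "'h \<Rightarrow> ('h \<times> 'h) list"
    and \<epsilon> :: "'h \<Rightarrow> 'k"
    and S :: "'h \<Rightarrow> 'h"
    and \<C> :: "'h set set"
begin

text \<open>Since \<open>c \<rightharpoonup> 1 = c(1) 1\<close>, all projections of \<open>1\<close> are multiples of \<open>1\<close>. One of them is nonzero, so its component contains the subcoalgebra \<open>k 1\<close> and equals it by simplicity.\<close>

lemma unit_component: "span {1} \<in> \<C>"
proof -
  obtain C where C: "C \<in> \<C>" "component_form C \<rightharpoonup> 1 \<noteq> 0"
    using component_projections_zero[of 1] by auto
  then have "component_form C 1 \<noteq> 0" using left_act_one[OF component_form_linear] by auto
  moreover have "component_form C 1 *s 1 \<in> C"
    using component_projection_in[OF C(1), of 1] left_act_one[OF component_form_linear, of C] by simp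
  ultimately have one: "1 \<in> C"
    using subspace_scale[OF component_subspace[OF C(1)], of "component_form C 1 *s 1" "inverse (component_form C 1)"]
    by simp
  have "subcoalgebra (span {1})"
    by (rule subcoalgebraI_stable, rule subspace_span)
      (auto simp: span_singleton left_act_one right_act_one linear_op_scale[OF linear_op_left_act]
        linear_op_scale[OF linear_op_right_act])
  moreover have "span {1} \<subseteq> C" using one component_subspace[OF C(1)] by (intro span_minimal) auto
  moreover have "span {1} \<noteq> {0}" using span_base[of 1 "{1}"] by auto
  ultimately have "span {1} = C" using simple[OF C(1)] unfolding simple_subcoalgebra_def by blast
  then show ?thesis using C(1) by simp
qed

text \<open>The idempotent \<open>\<mu>\<close> of the component \<open>k 1\<close> projects onto multiples of \<open>1\<close>, and applying the counit
  to \<open>\<mu> \<rightharpoonup> x\<close> identifies the multiple as \<open>\<mu> x\<close>. This is the left integral property.\<close>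

sublocale hopf_algebra_integral scale \<Delta> \<epsilon> S "component_form (span {1})"
proof (intro hopf_algebra_integral.intro hopf_algebra_integral_axioms.intro hopf_algebra_axioms)
  let ?\<mu> = "component_form (span {1})"
  have left: "?\<mu> \<rightharpoonup> x = ?\<mu> x *s 1" for x
  proof -
    obtain r where r: "?\<mu> \<rightharpoonup> x = r *s 1"
      using component_projection_in[OF unit_component, of x] by (auto simp: span_singleton)
    have "?\<mu> x = \<epsilon> (?\<mu> \<rightharpoonup> x)" by (simp add: counit_left_act component_form_linear)
    then show ?thesis using r by (simp add: linear_form_scale[OF counit_form] counit_one)
  qed
  show "linear_form ?\<mu>" by (rule component_form_linear)
  show "?\<mu> 1 = 1" using component_form_on[OF unit_component, of 1 "span {1}"] counit_one by (simp add: span_base)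
  show "sweedler x (\<lambda>a b. c a * ?\<mu> b) = ?\<mu> x * c 1" if "linear_form c" for c x
    using left[of x] form_left_act[OF that, of ?\<mu> x] by (simp add: linear_form_scale[OF that])
qed

abbreviation integral :: "'h \<Rightarrow> 'k" where
  "integral \<equiv> component_form (span {1})"

section \<open>The square of the antipode\<close>

text \<open>On each component \<open>C\<close> the form is \<open>\<mu> (- * S t)\<close> with a nonzero cocommutative \<open>t \<in> C\<close>. Faithfulness of the
  integral and injectivity of \<open>S\<close> give some \<open>y \<in> H\<close> with \<open>\<mu> (y * S t) \<noteq> 0\<close>. Balancedness moves the
  idempotent of \<open>C\<close> from \<open>t\<close> to \<open>y\<close>, which shows that \<open>y\<close> may be replaced by its projection to \<open>C\<close>.\<close>

lemma twisting_form_exists: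
  "\<exists>v. linear_form v \<and> (\<forall>x. S (S (v \<rightharpoonup> x)) = x \<leftharpoonup> v) \<and> (\<forall>C\<in>\<C>. \<exists>x\<in>C. v x \<noteq> 0)"
proof -
  have "\<forall>C\<in>\<C>. \<exists>t. t \<in> C \<and> t \<noteq> 0 \<and> cocommutative t"
    using cocommutative_exists[OF simple] by blast
  from bchoice[OF this]
  obtain t where "\<forall>C\<in>\<C>. t C \<in> C \<and> t C \<noteq> 0 \<and> cocommutative (t C)" by (rule exE)
  then have t: "t C \<in> C \<and> t C \<noteq> 0 \<and> cocommutative (t C)" if "C \<in> \<C>" for C
    using that by (rule bspec)
  define f where "f C x = integral (x * S (t C))" for C x
  have f: "linear_form (f C)" for C
    unfolding f_def by (intro multilinear_intros integral_intros)
  from linear_form_glue[OF direct f]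
  obtain v where glued: "linear_form v \<and> (\<forall>C\<in>\<C>. \<forall>x\<in>C. v x = f C x)" by (rule exE)
  then have v: "linear_form v" "\<And>C x. C \<in> \<C> \<Longrightarrow> x \<in> C \<Longrightarrow> v x = f C x" by simp_all
  have "S (S (v \<rightharpoonup> x)) = x \<leftharpoonup> v" for x
  proof (rule linear_op_eqI[of "\<lambda>x. S (S (v \<rightharpoonup> x))" "\<lambda>x. x \<leftharpoonup> v"])
    show "linear_op (\<lambda>x. S (S (v \<rightharpoonup> x)))"
      by (intro linear_op_antipode linear_op_left_act v)
    show "linear_op (\<lambda>x. x \<leftharpoonup> v)" by (intro linear_op_right_act v)
    fix C x assume C: "C \<in> \<C>" "x \<in> C"
    note sub = component_subcoalgebra[OF C(1)]
    have "S (S (f C \<rightharpoonup> x)) = x \<leftharpoonup> f C"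
    proof (rule linear_forms_eqI)
      fix c assume c: "linear_form c"
      have cS: "linear_form (\<lambda>x. c (S (S x)))" by (intro multilinear_intros linear_form_comp[OF c])
      show "c (S (S (f C \<rightharpoonup> x))) = c (x \<leftharpoonup> f C)"
        using cocommutative_twist[OF _ c, of "t C" x] t[OF C(1)]
        by (simp add: form_left_act[OF cS] form_right_act[OF c] f_def)
    qed
    then show "S (S (v \<rightharpoonup> x)) = x \<leftharpoonup> v"
      using left_act_cong[OF sub C(2) v(1) f v(2)[OF C(1)]]
        right_act_cong[OF sub C(2) v(1) f v(2)[OF C(1)]] by simp
  qed
  moreover have "\<exists>x\<in>C. v x \<noteq> 0" if C: "C \<in> \<C>" for C
  proof -
    have "S (t C) \<noteq> 0" using t[OF C] antipode_injective by blast
    then obtain y where y: "integral (y * S (t C)) \<noteq> 0" using integral_faithful by blast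
    let ?e = "component_form C"
    have lin: "linear_form (\<lambda>w. integral (y * S w))" "linear_form (\<lambda>w. integral (w * S (t C)))"
      by (intro multilinear_intros integral_intros)+
    have "integral (y * S (t C)) = integral (y * S (?e \<rightharpoonup> t C))"
      using t[OF C] by (simp add: component_projection_on[OF C])
    also have "\<dots> = sweedler (t C) (\<lambda>a b. integral (y * S a) * ?e b)"
      by (rule form_left_act[OF lin(1)])
    also have "\<dots> = sweedler y (\<lambda>a b. ?e a * integral (b * S (t C)))"
      by (rule integral_balanced[OF component_form_linear, symmetric])
    also have "\<dots> = integral ((y \<leftharpoonup> ?e) * S (t C))"
      by (rule form_right_act[OF lin(2), symmetric])
    also have "\<dots> = v (y \<leftharpoonup> ?e)"
      using v(2)[OF C] component_projection_in[OF C, of y] by (simp add: f_def component_form_central)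
    finally have "v (y \<leftharpoonup> ?e) \<noteq> 0" using y by simp
    moreover have "y \<leftharpoonup> ?e \<in> C" using component_projection_in[OF C, of y] by (simp add: component_form_central)
    ultimately show ?thesis by blast
  qed
  ultimately show ?thesis using v(1) by blast
qed

text \<open>By the twisting identity \<open>v \<rightharpoonup> x = 0\<close> holds if and only if \<open>x \<leftharpoonup> v = 0\<close>. As the two actions commute,
  the kernel is thus a subbimodule, and it meets a component \<open>C\<close> trivially: otherwise it contains \<open>C\<close>,
  and \<open>v x = \<epsilon> (v \<rightharpoonup> x)\<close> vanishes on \<open>C\<close>. So both actions of \<open>v\<close> are injective, and composing the
  counit with linear left inverses of them yields one-sided inverses of \<open>v\<close> for convolution.\<close>

lemma antipode_square_coinner:
  "\<exists>v w. linear_form v \<and> linear_form w \<and> convolution v w = \<epsilon> \<and> convolution w v = \<epsilon> \<and>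
     (\<forall>h. S (S h) = (w \<rightharpoonup> h) \<leftharpoonup> v)"
proof -
  obtain v where v: "linear_form v" and twist: "\<And>x. S (S (v \<rightharpoonup> x)) = x \<leftharpoonup> v"
    and nz: "\<And>C. C \<in> \<C> \<Longrightarrow> \<exists>x\<in>C. v x \<noteq> 0"
    using twisting_form_exists by blast
  have S0: "S (S 0) = 0" using linear_op_zero[OF antipode_linear] by simp
  have ker: "v \<rightharpoonup> x = 0 \<longleftrightarrow> x \<leftharpoonup> v = 0" for x
    using twist[of x] S0 antipode_injective by metis
  have inj0: "x = 0" if x: "v \<rightharpoonup> x = 0" for x
  proof (rule component_projections_zero)
    fix C assume C: "C \<in> \<C>"
    let ?e = "component_form C" and ?D = "{y \<in> C. v \<rightharpoonup> y = 0}"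
    have "subspace ?D"
      using component_subspace[OF C] linear_op_left_act[OF v]
      by (auto intro!: subspaceI simp: linear_op_zero linear_op_add linear_op_scale subspace_0
          subspace_add subspace_scale)
    moreover have "v \<rightharpoonup> c \<rightharpoonup> y = 0" if "v \<rightharpoonup> y = 0" and c: "linear_form c" for y c
      using that linear_op_zero[OF linear_op_left_act[OF c]] by (simp add: ker left_act_right_act v)
    moreover have "v \<rightharpoonup> (y \<leftharpoonup> c) = 0" if "v \<rightharpoonup> y = 0" and c: "linear_form c" for y c
      using that linear_op_zero[OF linear_op_right_act[OF c]] by (simp add: v flip: left_act_right_act)
    ultimately have "subcoalgebra ?D"
      using left_act_subcoalgebra[OF component_subcoalgebra[OF C]]
        right_act_subcoalgebra[OF component_subcoalgebra[OF C]]
      by (intro subcoalgebraI_stable) auto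
    moreover have "?D \<noteq> C"
    proof
      assume "?D = C"
      then have "C \<subseteq> ?D" by (rule equalityD2)
      then have "v y = 0" if "y \<in> C" for y
        using that counit_left_act[OF v, of y] linear_form_zero[OF counit_form] by auto
      then show False using nz[OF C] by blast
    qed
    ultimately have "?D = {0}" using simple[OF C] unfolding simple_subcoalgebra_def by blast
    moreover have "v \<rightharpoonup> ?e \<rightharpoonup> x = 0"
      using x linear_op_zero[OF linear_op_left_act[OF component_form_linear]]
      by (simp add: ker left_act_right_act v component_form_linear)
    ultimately show "?e \<rightharpoonup> x = 0" using component_projection_in[OF C, of x] by blast
  qed
  \<comment> \<open>For \<open>g x = v \<rightharpoonup> x\<close> the conclusion says that \<open>w v\<close> is the unit of the dual algebra, and for
    \<open>g x = x \<leftharpoonup> v\<close> that \<open>v w\<close> is.\<close>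
  have left_inverse: "\<exists>w. linear_form w \<and> (\<forall>x. w (g x) = \<epsilon> x)"
    if g: "linear_op g" "\<And>x. g x = 0 \<Longrightarrow> x = 0" for g
  proof -
    interpret vector_space_pair scale scale
      by (intro vector_space_pair.intro vector_space_axioms)
    have "inj g" using g linear_op_diff[OF g(1)] by (metis eq_iff_diff_eq_0 injI)
    then obtain k where k: "linear_op k" "k \<circ> g = id"
      using linear_injective_left_inverse[OF g(1)] by blast
    have "linear_form (\<lambda>x. \<epsilon> (k x))" by (rule linear_form_comp[OF counit_form k(1)])
    moreover have "\<epsilon> (k (g x)) = \<epsilon> x" for x using k(2) by (metis comp_apply id_apply)
    ultimately show ?thesis by blast
  qed
  obtain w where w: "linear_form w" "\<And>x. w (v \<rightharpoonup> x) = \<epsilon> x"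
    using left_inverse[OF linear_op_left_act[OF v] inj0] by blast
  obtain w' where w': "linear_form w'" "\<And>x. w' (x \<leftharpoonup> v) = \<epsilon> x"
    using left_inverse[OF linear_op_right_act[OF v]] inj0 ker by blast
  have wv: "convolution w v = \<epsilon>"
    using w(2) by (auto simp: convolution_sweedler form_left_act[OF w(1)])
  have vw': "convolution v w' = \<epsilon>"
    using w'(2) by (auto simp: convolution_sweedler form_right_act[OF w'(1)])
  have "w = convolution w (convolution v w')"
    by (auto simp: vw' convolution_sweedler sweedler_counit_right w(1))
  also have "\<dots> = convolution \<epsilon> w'"
    by (simp add: wv v w w' flip: convolution_assoc)
  also have "\<dots> = w'" by (auto simp: convolution_sweedler sweedler_counit_left w'(1))
  finally have vw: "convolution v w = \<epsilon>" using vw' by simp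
  have "S (S h) = (w \<rightharpoonup> h) \<leftharpoonup> v" for h
    using twist[of "w \<rightharpoonup> h"] by (simp add: left_act_left_act v w vw)
  then show ?thesis using v w(1) vw wv by blast
qed

end

theorem corollary8p4:
  fixes scale :: "'k::field \<Rightarrow> 'h::ring_1 \<Rightarrow> 'h"
    and \<Delta> :: "'h \<Rightarrow> ('h \<times> 'h) list"
    and \<epsilon> :: "'h \<Rightarrow> 'k"
    and S :: "'h \<Rightarrow> 'h"
  assumes "hopf_algebra scale \<Delta> \<epsilon> S"
    and "coalgebra.cosemisimple scale \<Delta>"
  shows "\<exists>u \<in> Units (coalgebra.dual_algebra scale \<Delta> \<epsilon>). \<forall>h.
           S (S h) =
           coalgebra.right_act scale \<Delta>
             (coalgebra.left_act scale \<Delta> (inv\<^bsub>coalgebra.dual_algebra scale \<Delta> \<epsilon>\<^esub> u) h) u"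
proof -
  interpret hopf_algebra scale \<Delta> \<epsilon> S by fact
  obtain \<C> where \<C>: "\<forall>C\<in>\<C>. simple_subcoalgebra C" "is_direct_sum \<C>"
    using assms(2) unfolding cosemisimple_def by blast
  interpret cosemisimple_hopf_algebra scale \<Delta> \<epsilon> S \<C>
    by unfold_locales (use \<C> in auto)
  interpret D: monoid dual_algebra by (rule dual_algebra_monoid)
  obtain v w where v: "linear_form v" and w: "linear_form w"
    and vw: "convolution v w = \<epsilon>" and wv: "convolution w v = \<epsilon>"
    and h: "\<And>h. S (S h) = (w \<rightharpoonup> h) \<leftharpoonup> v"
    using antipode_square_coinner by blast
  have carrier: "v \<in> carrier dual_algebra" "w \<in> carrier dual_algebra"
    using v w by (simp_all add: dual_algebra_def)
  have mult: "v \<otimes>\<^bsub>dual_algebra\<^esub> w = \<one>\<^bsub>dual_algebra\<^esub>" "w \<otimes>\<^bsub>dual_algebra\<^esub> v = \<one>\<^bsub>dual_algebra\<^esub>"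
    using vw wv by (simp_all add: dual_algebra_def)
  have unit: "v \<in> Units dual_algebra" using carrier mult unfolding Units_def by blast
  have "inv\<^bsub>dual_algebra\<^esub> v = w" using D.inv_char[OF carrier mult] .
  then show ?thesis using unit h by (intro bexI[of _ v]) simp_all
qed

end
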